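(* For every even integer $n\ge 18$ there exists a simple, nonplanar, bipartite, $3$-connected cubic graph $G$ with $n$ vertices and $K'(G,3)=1$.
   Context: A proper $3$-edge coloring assigns colors from $\{1,2,3\}$ to edges so that adjacent edges receive different colors. For colors $a\neq b$, an edge-Kempe chain is a connected component of the subgraph of edges colored $a$ or $b$; an edge-Kempe switch interchanges $a$ and $b$ on one chain. $K'(G,3)$ is the number of equivalence classes of proper $3$-edge colorings of $G$ under the equivalence relation generated by edge-Kempe switches. *)

theory Defs
  imports "HOL-Analysis.Analysis"
begin

text \<open>A finite simple graph on vertex set V: edges are 2-element subsets of V.\<close>
definition simple_graph :: "'v set \<Rightarrow> 'v set set \<Rightarrow> bool" where
  "simple_graph V E \<longleftrightarrow> finite V \<and> (\<forall>e\<in>E. e \<subseteq> V \<and> card e = 2)"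

definition cubic :: "'v set \<Rightarrow> 'v set set \<Rightarrow> bool" where
  "cubic V E \<longleftrightarrow> (\<forall>v\<in>V. card {e\<in>E. v \<in> e} = 3)"

definition bipartite :: "'v set \<Rightarrow> 'v set set \<Rightarrow> bool" where
  "bipartite V E \<longleftrightarrow> (\<exists>A\<subseteq>V. \<forall>e\<in>E. card (e \<inter> A) = 1)"

text \<open>Connectivity of the graph induced on a vertex set W.\<close>
definition connected_on :: "'v set \<Rightarrow> 'v set set \<Rightarrow> bool" where
  "connected_on W E \<longleftrightarrow>
     (\<forall>u\<in>W. \<forall>v\<in>W. (u, v) \<in> {(x, y). x \<in> W \<and> y \<in> W \<and> {x, y} \<in> E}\<^sup>*)"

text \<open>k-connected: more than k vertices, and removing fewer than k vertices leaves it connected.\<close>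
definition k_connected :: "nat \<Rightarrow> 'v set \<Rightarrow> 'v set set \<Rightarrow> bool" where
  "k_connected k V E \<longleftrightarrow> card V > k \<and>
     (\<forall>S\<subseteq>V. card S < k \<longrightarrow> connected_on (V - S) E)"

text \<open>Planarity (topological): vertices are distinct points of the plane, edges are arcs
  joining their endpoints, passing through no other vertex, and two distinct edges meet
  only in common endpoints.\<close>
definition planar :: "'v set \<Rightarrow> 'v set set \<Rightarrow> bool" where
  "planar V E \<longleftrightarrow> (\<exists>(p :: 'v \<Rightarrow> complex) (\<gamma> :: 'v set \<Rightarrow> real \<Rightarrow> complex).
      inj_on p V \<and>
      (\<forall>e\<in>E. arc (\<gamma> e) \<and> {pathstart (\<gamma> e), pathfinish (\<gamma> e)} = p ` e \<and>
               path_image (\<gamma> e) \<inter> p ` V = p ` e) \<and>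
      (\<forall>e\<in>E. \<forall>f\<in>E. e \<noteq> f \<longrightarrow> path_image (\<gamma> e) \<inter> path_image (\<gamma> f) = p ` (e \<inter> f)))"

text \<open>Proper 3-edge colorings with colors {1,2,3}; normalized to 0 outside E.\<close>
definition proper_3_edge_coloring :: "'v set set \<Rightarrow> ('v set \<Rightarrow> nat) \<Rightarrow> bool" where
  "proper_3_edge_coloring E c \<longleftrightarrow>
     (\<forall>e\<in>E. c e \<in> {1, 2, 3}) \<and> (\<forall>e. e \<notin> E \<longrightarrow> c e = 0) \<and>
     (\<forall>e\<in>E. \<forall>f\<in>E. e \<noteq> f \<and> e \<inter> f \<noteq> {} \<longrightarrow> c e \<noteq> c f)"

text \<open>Edge-Kempe chain: connected component (as edge set) of the subgraph of edges colored a or b.\<close>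
definition kempe_chain ::
  "'v set set \<Rightarrow> ('v set \<Rightarrow> nat) \<Rightarrow> nat \<Rightarrow> nat \<Rightarrow> 'v set set \<Rightarrow> bool" where
  "kempe_chain E c a b C \<longleftrightarrow>
     (\<exists>e\<in>E. c e \<in> {a, b} \<and>
        C = {(x, y). x \<in> E \<and> y \<in> E \<and> c x \<in> {a, b} \<and> c y \<in> {a, b} \<and> x \<inter> y \<noteq> {}}\<^sup>* `` {e})"

definition kempe_switch :: "('v set \<Rightarrow> nat) \<Rightarrow> nat \<Rightarrow> nat \<Rightarrow> 'v set set \<Rightarrow> 'v set \<Rightarrow> nat" where
  "kempe_switch c a b C = (\<lambda>e. if e \<in> C then (if c e = a then b else if c e = b then a else c e) else c e)"

definition kempe_step :: "'v set set \<Rightarrow> (('v set \<Rightarrow> nat) \<times> ('v set \<Rightarrow> nat)) set" where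
  "kempe_step E = {(c, c'). proper_3_edge_coloring E c \<and>
      (\<exists>a b C. a \<in> {1, 2, 3} \<and> b \<in> {1, 2, 3} \<and> a \<noteq> b \<and> kempe_chain E c a b C \<and>
               c' = kempe_switch c a b C)}"

definition edge_kempe_classes :: "'v set set \<Rightarrow> nat" where
  "edge_kempe_classes E =
     card ({c. proper_3_edge_coloring E c} // ((kempe_step E \<union> (kempe_step E)\<inverse>)\<^sup>*))"

end

theory Submission
  imports Defs
begin

text \<open>
  Two colorings that agree on one color class are Kempe equivalent, so it suffices to connect all
  colorings of a graph by steps that keep a color class. In a ladder, colors are transported along the
  two rails: if the rails carry different colors, two consecutive rungs act as the identity; if they
  carry equal colors, the rail colors form a walk in the triangle on the three colors, and such walks
  can be moved to one another by class-preserving steps. Hence lengthening a ladder with at least two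
  rungs by two further rungs preserves \<open>K' = 1\<close>, and one base graph for each even residue of \<open>n\<close> modulo 4 is enough.
  The bases have 12 and 18 vertices; their few colorings are enumerated.

  Adding a rung (subdividing two edges and joining the new vertices) preserves being cubic and
  3-connected, and it preserves nonplanarity, because a drawing of the larger graph yields one of the smaller.
  Everything grows in this way from \<open>K\<^sub>3\<^sub>,\<^sub>3\<close>: a drawing of it would be a theta curve together with a
  connected set that reaches all three arms of the theta from a single face.
\<close>

section \<open>Theta curves and the nonplanarity of \<open>K\<^sub>3\<^sub>,\<^sub>3\<close>\<close>

text \<open>A Kempe switch follows a chain that may run through the whole graph, so it cannot be
  traced inside a ladder alone. Keeping a color class is a symmetric condition on single edges and
  can be verified on a strip without knowing the rest of the graph. New rungs can be removed again
  only if they hand back the rail colors they received. When the rails agree, the walk must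
  therefore be moved, with both ends fixed, until its last two steps cancel. On three rungs this can
  fail: a closed walk of three steps in a triangle is a full turn and never backtracks. Four rungs
  always suffice, so two must already be present before two are added. Rungs also come in pairs
  because of bipartiteness: the ends of a subdivided edge lie on opposite sides, so one insertion
  spoils the bipartition and the second restores it. Hence the order grows by 4, and the sides are
  tracked apart from the properties that survive a single insertion.\<close>

definition arc_image :: "complex \<Rightarrow> complex \<Rightarrow> complex set \<Rightarrow> bool" where
  "arc_image a b I \<longleftrightarrow> (\<exists>g. arc g \<and> path_image g = I \<and> pathstart g = a \<and> pathfinish g = b)"

lemma arc_image_sym: "arc_image a b I \<Longrightarrow> arc_image b a I"
  unfolding arc_image_def by (metis arc_reversepath path_image_reversepath pathfinish_reversepath pathstart_reversepath)

lemma arc_image_ends: "arc_image a b I \<Longrightarrow> a \<in> I \<and> b \<in> I \<and> a \<noteq> b"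
  unfolding arc_image_def by (metis arc_distinct_ends pathfinish_in_path_image pathstart_in_path_image)

lemma arc_image_compact: "arc_image a b I \<Longrightarrow> compact I"
  unfolding arc_image_def by (metis compact_path_image arc_imp_path)

lemma arc_image_join:
  assumes "arc_image a b I" "arc_image b c J" "I \<inter> J = {b}"
  shows "arc_image a c (I \<union> J)"
proof -
  obtain g where g: "arc g" "path_image g = I" "pathstart g = a" "pathfinish g = b"
    using assms(1) by (auto simp: arc_image_def)
  obtain h where h: "arc h" "path_image h = J" "pathstart h = b" "pathfinish h = c"
    using assms(2) by (auto simp: arc_image_def)
  have "arc (g +++ h)" using g h assms(3) by (intro arc_join) auto
  moreover have "path_image (g +++ h) = I \<union> J" using g h by (simp add: path_image_join)
  ultimately show ?thesis using g h unfolding arc_image_def by (metis pathstart_join pathfinish_join)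
qed

text \<open>Makes an edge without its ends usable as a connected set whose closure reaches the end
  vertices again: the arc is the continuous image of the closure of the open unit interval.\<close>

lemma arc_image_endless_connected:
  assumes "arc_image a b I" shows "connected (I - {a, b})" "I \<subseteq> closure (I - {a, b})"
proof -
  obtain g where g: "arc g" "path_image g = I" "pathstart g = a" "pathfinish g = b"
    using assms by (auto simp: arc_image_def)
  show "connected (I - {a, b})" using connected_simple_path_endless arc_imp_simple_path g by blast
  have "g ` closure {0<..<1} \<subseteq> closure (g ` {0<..<1})"
    using g(1) by (intro image_closure_subset closure_subset) (auto simp: arc_def path_def)
  then show "I \<subseteq> closure (I - {a, b})"
    using simple_path_endless[OF arc_imp_simple_path[OF g(1)]] g by (simp add: path_image_def)
qed

lemma theta_cycle:
  assumes "arc_image a b I" "arc_image a b J" "I \<inter> J = {a, b}"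
  obtains c where "simple_path c" "pathfinish c = pathstart c" "path_image c = I \<union> J"
proof -
  obtain g where g: "arc g" "path_image g = I" "pathstart g = a" "pathfinish g = b"
    using assms(1) by (auto simp: arc_image_def)
  obtain h where h: "arc h" "path_image h = J" "pathstart h = b" "pathfinish h = a"
    using arc_image_sym[OF assms(2)] by (auto simp: arc_image_def)
  have "simple_path (g +++ h)" using g h assms(3) by (intro simple_path_join_loop) auto
  moreover have "path_image (g +++ h) = I \<union> J" using g h by (simp add: path_image_join)
  ultimately show ?thesis using that g h by (metis pathstart_join pathfinish_join)
qed

lemma theta_Jordan:
  assumes "arc_image a b I" "arc_image a b J" "I \<inter> J = {a, b}"
  shows "inside (I \<union> J) \<noteq> {}" "open (inside (I \<union> J))" "connected (inside (I \<union> J))"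
    "open (outside (I \<union> J))" "connected (outside (I \<union> J))"
    "inside (I \<union> J) \<inter> outside (I \<union> J) = {}" 
    "inside (I \<union> J) \<union> outside (I \<union> J) = - (I \<union> J)"
    "closure (inside (I \<union> J)) = inside (I \<union> J) \<union> (I \<union> J)"
    "closure (outside (I \<union> J)) = outside (I \<union> J) \<union> (I \<union> J)"
proof -
  obtain c where c: "simple_path c" "pathfinish c = pathstart c" "path_image c = I \<union> J"
    using theta_cycle assms by blast
  note J = Jordan_inside_outside[OF c(1,2), unfolded c(3)]
  show "inside (I \<union> J) \<noteq> {}" "open (inside (I \<union> J))" "connected (inside (I \<union> J))"
    "open (outside (I \<union> J))" "connected (outside (I \<union> J))"
    "inside (I \<union> J) \<inter> outside (I \<union> J) = {}" 
    "inside (I \<union> J) \<union> outside (I \<union> J) = - (I \<union> J)" using J by auto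
  show "closure (inside (I \<union> J)) = inside (I \<union> J) \<union> (I \<union> J)"
    using J closure_Un_frontier[of "inside (I \<union> J)"] by simp
  show "closure (outside (I \<union> J)) = outside (I \<union> J) \<union> (I \<union> J)"
    using J closure_Un_frontier[of "outside (I \<union> J)"] by simp
qed

lemma connected_cases:
  assumes "connected D" "open U" "open V" "U \<inter> V = {}" "D \<subseteq> U \<union> V"
  shows "D \<subseteq> U \<or> D \<subseteq> V"
  using connectedD[OF assms(1,2,3)] assms(4,5) by blast

text \<open>
  Otherwise a point inside \<open>J \<union> K\<close> could be joined to a far away point in the complement of \<open>I \<union> J\<close> and in
  that of \<open>I \<union> K\<close>, hence by Janiszewski's theorem in the complement of \<open>J \<union> K\<close>.
\<close>
lemma theta_not_all_outside:
  assumes I: "arc_image a b I" and J: "arc_image a b J" and K: "arc_image a b K"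
    and IJ: "I \<inter> J = {a, b}" and IK: "I \<inter> K = {a, b}" and JK: "J \<inter> K = {a, b}"
    and qI: "I \<noteq> {a, b}" and qJ: "J \<noteq> {a, b}" and qK: "K \<noteq> {a, b}"
  shows "I \<inter> inside (J \<union> K) \<noteq> {} \<or> J \<inter> inside (I \<union> K) \<noteq> {} \<or> K \<inter> inside (I \<union> J) \<noteq> {}"
proof (rule ccontr)
  assume "\<not> ?thesis"
  then have o: "I \<inter> inside (J \<union> K) = {}" "J \<inter> inside (I \<union> K) = {}" "K \<inter> inside (I \<union> J) = {}" by auto
  note tIJ = theta_Jordan[OF I J IJ] and tIK = theta_Jordan[OF I K IK] and tJK = theta_Jordan[OF J K JK]
  \<comment> \<open>The connected set \<open>inside (J \<union> K)\<close> avoids \<open>I\<close>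
    by assumption, and \<open>J\<close>, hence lies in one face of \<open>I \<union> J\<close>. It
    is not the inner one: \<open>K\<close> lies in its closure, so \<open>K\<close> would be
    contained in \<open>I \<union> J\<close>, although it has points besides \<open>a\<close> and
    \<open>b\<close>.\<close>
  have sub1: "inside (J \<union> K) \<subseteq> outside (I \<union> J)"
  proof -
    have "\<not> inside (J \<union> K) \<subseteq> inside (I \<union> J)"
    proof
      assume "inside (J \<union> K) \<subseteq> inside (I \<union> J)"
      then have "closure (inside (J \<union> K)) \<subseteq> closure (inside (I \<union> J))" by (rule closure_mono)
      then have "K \<subseteq> inside (I \<union> J) \<union> (I \<union> J)" using tJK(8) tIJ(8) by auto
      then have "K \<subseteq> I \<union> J" using o by auto
      then show False using IK JK qK by auto
    qed
    moreover have "inside (J \<union> K) \<subseteq> inside (I \<union> J) \<union> outside (I \<union> J)"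
      using tIJ(7) tJK(7) o(1) by blast
    ultimately show ?thesis using connected_cases[OF tJK(3) tIJ(2,4,6)] by blast
  qed
  have sub2: "inside (J \<union> K) \<subseteq> outside (I \<union> K)"
  proof -
    have "\<not> inside (J \<union> K) \<subseteq> inside (I \<union> K)"
    proof
      assume "inside (J \<union> K) \<subseteq> inside (I \<union> K)"
      then have "closure (inside (J \<union> K)) \<subseteq> closure (inside (I \<union> K))" by (rule closure_mono)
      then have "J \<subseteq> inside (I \<union> K) \<union> (I \<union> K)" using tJK(8) tIK(8) by auto
      then have "J \<subseteq> I \<union> K" using o by auto
      then show False using IJ JK qJ by auto
    qed
    moreover have "inside (J \<union> K) \<subseteq> inside (I \<union> K) \<union> outside (I \<union> K)"
      using tIK(7) tJK(7) o(1) by blast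
    ultimately show ?thesis using connected_cases[OF tJK(3) tIK(2,4,6)] by blast
  qed
  obtain x where x: "x \<in> inside (J \<union> K)" using tJK(1) by auto
  have cI: "compact I" and cJ: "compact J" and cK: "compact K" using I J K arc_image_compact by auto
  then have "bounded (I \<union> J \<union> K)" by (simp add: compact_imp_bounded)
  then have "outside (I \<union> J \<union> K) \<noteq> {}" by (rule outside_bounded_nonempty)
  then obtain y where y: "y \<in> outside (I \<union> J \<union> K)" by auto
  have y1: "y \<in> outside (I \<union> J)" "y \<in> outside (I \<union> K)" "y \<in> outside (J \<union> K)"
    using y outside_mono[of "I \<union> J" "I \<union> J \<union> K"] outside_mono[of "I \<union> K" "I \<union> J \<union> K"]
      outside_mono[of "J \<union> K" "I \<union> J \<union> K"] by blast+
  have c1: "connected_component (- (I \<union> J)) x y"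
    unfolding connected_component_def using tIJ(5,7) sub1 x y1 by blast
  have c2: "connected_component (- (I \<union> K)) x y"
    unfolding connected_component_def using tIK(5,7) sub2 x y1 by blast
  \<comment> \<open>The two closed sets meet exactly in the arc \<open>I\<close>; that this
    intersection is connected is what Janiszewski's theorem asks for.\<close>
  have "(I \<union> J) \<inter> (I \<union> K) = I" using JK arc_image_ends[OF I] by auto
  moreover have "connected I" using I unfolding arc_image_def by (metis connected_path_image arc_imp_path)
  ultimately have "connected_component (- ((I \<union> J) \<union> (I \<union> K))) x y"
    using Janiszewski[of "I \<union> J" "I \<union> K" x y] c1 c2 cI cJ cK by (simp add: compact_Un compact_imp_closed)
  then have "connected_component (- (J \<union> K)) x y"
    by (rule connected_component_of_subset) auto
  then have "y \<in> inside (J \<union> K)" using x inside_same_component by blast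
  then show False using y1 tJK(6) by blast
qed

text \<open>Here \<open>K\<close> is a chord of the Jordan curve \<open>I \<union> J\<close>, so the
  theta curve has the three faces \<open>outside (I \<union> J)\<close>,
  \<open>inside (I \<union> K)\<close> and \<open>inside (J \<union> K)\<close>. The connected set
  \<open>D\<close> lies in one of them, and the closure of each face misses the interior of one arm:
  that of \<open>K\<close>, \<open>J\<close> and \<open>I\<close>, respectively.\<close>

lemma theta_inside_no_tripod:
  assumes I: "arc_image a b I" and J: "arc_image a b J" and K: "arc_image a b K"
    and IJ: "I \<inter> J = {a, b}" and IK: "I \<inter> K = {a, b}" and JK: "J \<inter> K = {a, b}"
    and ins: "K \<inter> inside (I \<union> J) \<noteq> {}"
    and D: "connected D" "D \<inter> (I \<union> J \<union> K) = {}"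
    and cl: "(I - {a, b}) \<inter> closure D \<noteq> {}" "(J - {a, b}) \<inter> closure D \<noteq> {}" "(K - {a, b}) \<inter> closure D \<noteq> {}"
  shows False
proof -
  obtain i where i: "arc i" "path_image i = I" "pathstart i = a" "pathfinish i = b"
    using I by (auto simp: arc_image_def)
  obtain j where j: "arc j" "path_image j = J" "pathstart j = a" "pathfinish j = b"
    using J by (auto simp: arc_image_def)
  obtain k where k: "arc k" "path_image k = K" "pathstart k = a" "pathfinish k = b"
    using K by (auto simp: arc_image_def)
  have sp: "inside (I \<union> K) \<inter> inside (J \<union> K) = {}"
    "inside (I \<union> K) \<union> inside (J \<union> K) \<union> (K - {a, b}) = inside (I \<union> J)"
    using split_inside_simple_closed_curve[of i a b j k] i j k IJ IK JK ins arc_image_ends[OF I]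
    by (auto simp: arc_imp_simple_path)
  note tIJ = theta_Jordan[OF I J IJ] and tIK = theta_Jordan[OF I K IK] and tJK = theta_Jordan[OF J K JK]
  have "D \<subseteq> inside (I \<union> J) \<union> outside (I \<union> J)" using D(2) tIJ(7) by blast
  then consider "D \<subseteq> outside (I \<union> J)" | "D \<subseteq> inside (I \<union> J)"
    using connected_cases[OF D(1) tIJ(2,4,6)] by blast
  then show False
  proof cases
    case 1
    then have "closure D \<subseteq> outside (I \<union> J) \<union> (I \<union> J)" using closure_mono tIJ(9) by metis
    moreover have "K - {a, b} \<subseteq> inside (I \<union> J)" using sp by auto
    ultimately show False using cl(3) tIJ(6) IK JK by blast
  next
    case 2
    then have "D \<subseteq> inside (I \<union> K) \<union> inside (J \<union> K)" using sp D(2) by blast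
    then consider "D \<subseteq> inside (I \<union> K)" | "D \<subseteq> inside (J \<union> K)"
      using connected_cases[OF D(1) tIK(2) tJK(2) sp(1)] by blast
    then show False
    proof cases
      case 1
      then have "closure D \<subseteq> inside (I \<union> K) \<union> (I \<union> K)" using closure_mono tIK(8) by metis
      then show False using cl(2) IJ JK sp(2) tIJ(7) by blast
    next
      case 2
      then have "closure D \<subseteq> inside (J \<union> K) \<union> (J \<union> K)" using closure_mono tJK(8) by metis
      then show False using cl(1) IJ IK sp(2) tIJ(7) by blast
    qed
  qed
qed

text \<open>The hypotheses are symmetric in the three arms, and some arm is a chord of the curve
  formed by the other two. The conditions \<open>cl\<close> also show that each arm has a point
  besides \<open>a\<close> and \<open>b\<close>.\<close>

lemma theta_no_tripod:
  assumes I: "arc_image a b I" and J: "arc_image a b J" and K: "arc_image a b K"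
    and IJ: "I \<inter> J = {a, b}" and IK: "I \<inter> K = {a, b}" and JK: "J \<inter> K = {a, b}"
    and D: "connected D" "D \<inter> (I \<union> J \<union> K) = {}"
    and cl: "(I - {a, b}) \<inter> closure D \<noteq> {}" "(J - {a, b}) \<inter> closure D \<noteq> {}" "(K - {a, b}) \<inter> closure D \<noteq> {}"
  shows False
proof -
  consider "I \<inter> inside (J \<union> K) \<noteq> {}" | "J \<inter> inside (I \<union> K) \<noteq> {}" | "K \<inter> inside (I \<union> J) \<noteq> {}"
    using theta_not_all_outside[OF I J K IJ IK JK] cl by blast
  then show False
  proof cases
    case 1
    then show ?thesis using theta_inside_no_tripod[OF J K I JK _ _ _ D(1)] IJ IK D(2) cl by (auto simp: Int_commute Un_ac)
  next
    case 2
    then show ?thesis using theta_inside_no_tripod[OF I K J IK _ _ _ D(1)] IJ JK D(2) cl by (auto simp: Int_commute Un_ac)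
  next
    case 3
    then show ?thesis using theta_inside_no_tripod[OF I J K IJ IK JK _ D(1)] D(2) cl by auto
  qed
qed

text \<open>\<open>planar\<close> gives the ends of an edge only as an unordered pair; reversing the
  arc makes their order irrelevant.\<close>

lemma arc_image_iff: 
  "(\<exists>g. arc g \<and> path_image g = I \<and> {pathstart g, pathfinish g} = {a, b}) \<longleftrightarrow> arc_image a b I"
proof
  assume "\<exists>g. arc g \<and> path_image g = I \<and> {pathstart g, pathfinish g} = {a, b}"
  then obtain g where "arc g" "path_image g = I" "{pathstart g, pathfinish g} = {a, b}" by blast
  then have "arc_image a b I \<or> arc_image b a I" unfolding arc_image_def by (auto simp: doubleton_eq_iff)
  then show "arc_image a b I" using arc_image_sym by blast
qed (auto simp: arc_image_def)

section \<open>Drawings, their restriction, and the smoothing of a subdivided edge\<close>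

definition drawing :: "'v set \<Rightarrow> 'v set set \<Rightarrow> ('v \<Rightarrow> complex) \<Rightarrow> ('v set \<Rightarrow> real \<Rightarrow> complex) \<Rightarrow> bool" where
  "drawing V E p \<gamma> \<longleftrightarrow> inj_on p V \<and>
      (\<forall>e\<in>E. arc (\<gamma> e) \<and> {pathstart (\<gamma> e), pathfinish (\<gamma> e)} = p ` e \<and>
               path_image (\<gamma> e) \<inter> p ` V = p ` e) \<and>
      (\<forall>e\<in>E. \<forall>f\<in>E. e \<noteq> f \<longrightarrow> path_image (\<gamma> e) \<inter> path_image (\<gamma> f) = p ` (e \<inter> f))"

lemma planar_iff_drawing: "planar V E \<longleftrightarrow> (\<exists>p \<gamma>. drawing V E p \<gamma>)"
  by (simp only: planar_def drawing_def)

lemma drawingD: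
  assumes "drawing V E p \<gamma>"
  shows "inj_on p V"
    and "e \<in> E \<Longrightarrow> arc (\<gamma> e) \<and> {pathstart (\<gamma> e), pathfinish (\<gamma> e)} = p ` e \<and> path_image (\<gamma> e) \<inter> p ` V = p ` e"
    and "e \<in> E \<Longrightarrow> f \<in> E \<Longrightarrow> e \<noteq> f \<Longrightarrow> path_image (\<gamma> e) \<inter> path_image (\<gamma> f) = p ` (e \<inter> f)"
proof -
  note d = assms[unfolded drawing_def]
  show "inj_on p V" by (rule conjunct1[OF d])
  show "e \<in> E \<Longrightarrow> arc (\<gamma> e) \<and> {pathstart (\<gamma> e), pathfinish (\<gamma> e)} = p ` e \<and> path_image (\<gamma> e) \<inter> p ` V = p ` e"
    by (rule bspec[OF conjunct1[OF conjunct2[OF d]]])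
  show "e \<in> E \<Longrightarrow> f \<in> E \<Longrightarrow> e \<noteq> f \<Longrightarrow> path_image (\<gamma> e) \<inter> path_image (\<gamma> f) = p ` (e \<inter> f)"
    using conjunct2[OF conjunct2[OF d]] by simp
qed

lemma drawing_arc_image:
  assumes "drawing V E p \<gamma>" "{a, b} \<in> E"
  shows "arc_image (p a) (p b) (path_image (\<gamma> {a, b}))"
proof -
  have "arc (\<gamma> {a, b})" "{pathstart (\<gamma> {a, b}), pathfinish (\<gamma> {a, b})} = {p a, p b}"
    using drawingD(2)[OF assms] by simp_all
  then show ?thesis by (intro arc_image_iff[THEN iffD1] exI[of _ "\<gamma> {a, b}"] conjI) simp_all
qed

lemma planar_mono:
  assumes "planar V E" "F \<subseteq> E" "W \<subseteq> V" "\<And>e. e \<in> F \<Longrightarrow> e \<subseteq> W"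
  shows "planar W F"
proof -
  obtain p \<gamma> where d: "drawing V E p \<gamma>" using assms(1) planar_iff_drawing by blast
  have "path_image (\<gamma> e) \<inter> p ` W = p ` e" if "e \<in> F" for e
  proof -
    have "e \<in> E" using assms(2) that by blast
    from drawingD(2)[OF d this] have "path_image (\<gamma> e) \<inter> p ` V = p ` e" by blast
    moreover have "p ` e \<subseteq> p ` W" "p ` W \<subseteq> p ` V" using assms(3,4) that by (simp_all add: image_mono)
    moreover have "A \<inter> B = C \<Longrightarrow> C \<subseteq> B' \<Longrightarrow> B' \<subseteq> B \<Longrightarrow> A \<inter> B' = C" for A B B' C :: "complex set"
      by blast
    ultimately show ?thesis by metis
  qed
  then have "drawing W F p \<gamma>"
    unfolding drawing_def using drawingD[OF d] assms(2) inj_on_subset[OF drawingD(1)[OF d] assms(3)]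
    by (simp add: subset_eq)
  then show ?thesis using planar_iff_drawing by blast
qed

text \<open>The arcs of the two edges at \<open>x\<close> meet only in the image of
  \<open>x\<close>, so they join to one arc from \<open>a\<close> to \<open>b\<close>, whose
  intersections with other edges are inherited from the two halves.\<close>

lemma planar_smooth:
  assumes pl: "planar (insert x V) (insert {a, x} (insert {x, b} E))"
    and x: "x \<notin> V" and ab: "a \<in> V" "b \<in> V" "a \<noteq> b" and E: "\<And>e. e \<in> E \<Longrightarrow> e \<subseteq> V"
  shows "planar V (insert {a, b} E)"
proof -
  let ?E = "insert {a, x} (insert {x, b} E)"
  obtain p \<gamma> where d: "drawing (insert x V) ?E p \<gamma>" using planar_iff_drawing pl by blast
  note inj = drawingD(1)[OF d] and A = drawingD(2)[OF d] and B = drawingD(3)[OF d]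
  let ?I = "\<lambda>e. path_image (\<gamma> e)"
  have xab: "x \<noteq> a" "x \<noteq> b" using x ab by auto
  have "arc_image (p a) (p x) (?I {a, x})" "arc_image (p x) (p b) (?I {x, b})"
    by (rule drawing_arc_image[OF d], simp)+
  moreover have "?I {a, x} \<inter> ?I {x, b} = {p x}"
    using B[of "{a,x}" "{x,b}"] xab ab by (auto simp: doubleton_eq_iff)
  ultimately have "arc_image (p a) (p b) (?I {a, x} \<union> ?I {x, b})"
    by (rule arc_image_join)
  then obtain g where g: "arc g" "path_image g = ?I {a, x} \<union> ?I {x, b}" "{pathstart g, pathfinish g} = {p a, p b}"
    using arc_image_iff[THEN iffD2] by metis
  \<comment> \<open>If \<open>{a, b}\<close> was already an edge, its former arc is discarded
    here.\<close>
  define \<delta> where "\<delta> = \<gamma>({a, b} := g)"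
  have px: "p x \<notin> p ` V" using inj x by (auto simp: inj_on_def)
  have "?I {a, x} \<inter> insert (p x) (p ` V) = {p a, p x}" "?I {x, b} \<inter> insert (p x) (p ` V) = {p x, p b}"
    using A[of "{a,x}"] A[of "{x,b}"] by simp_all
  moreover have "A \<inter> B = {u}" if "A \<inter> insert v B = {u, v}" "v \<notin> B" "u \<in> B" for A B and u v :: complex
    using that by blast
  ultimately have "?I {a, x} \<inter> p ` V = {p a}" "?I {x, b} \<inter> p ` V = {p b}"
    using px ab by (metis imageI insert_commute)+
  then have gV: "path_image g \<inter> p ` V = p ` {a, b}" using g(2) by auto
  have gf: "path_image g \<inter> ?I f = p ` ({a, b} \<inter> f)" if "f \<in> E" for f
  proof -
    have f: "f \<subseteq> V" using E that by auto
    have "?I {a, x} \<inter> ?I f = p ` ({a, x} \<inter> f)" "?I {x, b} \<inter> ?I f = p ` ({x, b} \<inter> f)"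
      using B[of "{a,x}" f] B[of "{x,b}" f] that x f by auto
    then show ?thesis using g(2) x f by auto
  qed
  have "drawing V (insert {a, b} E) p \<delta>" unfolding drawing_def
  proof (intro conjI ballI impI)
    show "inj_on p V" using inj by simp
    have dg: "\<delta> {a, b} = g" and de: "\<And>e. e \<noteq> {a, b} \<Longrightarrow> \<delta> e = \<gamma> e" by (simp_all add: \<delta>_def)
    fix e assume e: "e \<in> insert {a, b} E"
    have V: "path_image (\<gamma> e) \<inter> p ` V = p ` e" if "e \<in> E" for e
    proof -
      have "path_image (\<gamma> e) \<inter> insert (p x) (p ` V) = p ` e" using A[of e] that by simp
      moreover have "p x \<notin> p ` e" using px E[OF that] by blast
      moreover have "A \<inter> B = C" if "A \<inter> insert v B = C" "v \<notin> C" for A B C and v :: complex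
        using that by blast
      ultimately show ?thesis by metis
    qed
    have "arc (\<delta> e) \<and> {pathstart (\<delta> e), pathfinish (\<delta> e)} = p ` e \<and> path_image (\<delta> e) \<inter> p ` V = p ` e"
    proof (cases "e = {a, b}")
      case True
      show ?thesis unfolding True dg using g(1,3) gV by simp
    next
      case False
      then show ?thesis unfolding de[OF False] using A[of e] V[of e] e by simp
    qed
    then show "arc (\<delta> e)" "{pathstart (\<delta> e), pathfinish (\<delta> e)} = p ` e" "path_image (\<delta> e) \<inter> p ` V = p ` e"
      by blast+
    fix f assume f: "f \<in> insert {a, b} E" "e \<noteq> f"
    show "path_image (\<delta> e) \<inter> path_image (\<delta> f) = p ` (e \<inter> f)"
    proof (cases "e = {a, b}")
      case True
      then show ?thesis using gf[of f] f de[of f] dg by simp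
    next
      case e': False
      show ?thesis
      proof (cases "f = {a, b}")
        case True
        then show ?thesis using gf[of e] e e' de[of e] dg by (simp add: Int_commute)
      next
        case False
        then show ?thesis using B[of e f] e f e' de by simp
      qed
    qed
  qed
  then show ?thesis using planar_iff_drawing by blast
qed

definition K33 :: "nat set set" where
  "K33 = {{0,3},{0,4},{0,5},{1,3},{1,4},{1,5},{2,3},{2,4},{2,5}}"

lemma K33_edge:
  assumes "i < 3" "j \<in> {3,4,5}"
  shows "{i, j} \<in> K33"
proof -
  have "i = 0 \<or> i = 1 \<or> i = 2" using assms(1) by linarith
  then show ?thesis using assms(2) unfolding K33_def by (elim disjE insertE emptyE) simp_all
qed

text \<open>The paths 3-\<open>i\<close>-4 for \<open>i\<close> = 0, 1, 2 are the arms
  \<open>J i\<close> of a theta curve with ends 3 and 4. Vertex 5 with its three edges is the tripod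
  \<open>D\<close>.\<close>

lemma K33_nonplanar: "\<not> planar {0..<6} K33"
proof
  assume "planar {0..<6} K33"
  then obtain p \<gamma> where d: "drawing {0..<6} K33 p \<gamma>" using planar_iff_drawing by blast
  note inj = drawingD(1)[OF d] and A = drawingD(2)[OF d] and B = drawingD(3)[OF d]
  define I where "I i j = path_image (\<gamma> {i, j})" for i j
  have ar: "arc_image (p i) (p j) (I i j)" if "i < 3" "j \<in> {3,4,5}" for i j
    unfolding I_def by (rule drawing_arc_image[OF d K33_edge[OF that]])
  have pI: "p k \<in> I i j \<longleftrightarrow> k = i \<or> k = j" if "i < 3" "j \<in> {3,4,5}" "k < 6" for i j k
  proof -
    have "I i j \<inter> p ` {0..<6} = p ` {i, j}" using A[OF K33_edge[OF that(1,2)]] by (simp add: I_def)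
    moreover have "p k \<in> p ` {0..<6}" using that(3) by simp
    ultimately have "p k \<in> I i j \<longleftrightarrow> p k \<in> p ` {i, j}" by (metis Int_iff)
    also have "\<dots> \<longleftrightarrow> k = i \<or> k = j" using that inj by (auto simp: inj_on_def)
    finally show ?thesis .
  qed
  have II: "I i j \<inter> I i' j' = p ` ({i, j} \<inter> {i', j'})" if "i < 3" "j \<in> {3,4,5}" "i' < 3" "j' \<in> {3,4,5}" "{i,j} \<noteq> {i',j'}" for i j i' j'
    unfolding I_def by (rule B) (use that K33_edge in auto)
  define J where "J i = I i 3 \<union> I i 4" for i
  have J: "arc_image (p 3) (p 4) (J i)" if "i < 3" for i
    unfolding J_def
  proof (rule arc_image_join)
    show "arc_image (p 3) (p i) (I i 3)" using ar[of i 3] that arc_image_sym by auto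
    show "arc_image (p i) (p 4) (I i 4)" using ar[of i 4] that by auto
    show "I i 3 \<inter> I i 4 = {p i}" using II[of i 3 i 4] that by (auto simp: doubleton_eq_iff)
  qed
  have JJ: "J i \<inter> J k = {p 3, p 4}" if "i < 3" "k < 3" "i \<noteq> k" for i k
  proof -
    have "I i 3 \<inter> I k 3 = {p 3}" "I i 4 \<inter> I k 4 = {p 4}" "I i 3 \<inter> I k 4 = {}" "I i 4 \<inter> I k 3 = {}"
      using II[of i 3 k 3] II[of i 4 k 4] II[of i 3 k 4] II[of i 4 k 3] that by (auto simp: doubleton_eq_iff)
    then show ?thesis unfolding J_def by auto
  qed
  \<comment> \<open>The edge from 5 to \<open>i\<close> without its end at \<open>i\<close>: this
    keeps \<open>D\<close> disjoint from the theta curve, while the closure of \<open>D\<close>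
    still meets each arm in the inner point \<open>p i\<close>.\<close>
  define T where "T i = insert (p 5) (I i 5 - {p i, p 5})" for i
  define D where "D = T 0 \<union> T 1 \<union> T 2"
  have T: "connected (T i)" "p i \<in> closure (T i)" if "i < 3" for i
  proof -
    note a = arc_image_endless_connected[OF ar[of i 5]]
    have i: "p 5 \<in> I i 5" "p i \<in> I i 5" using pI[of i 5] that by auto
    show "connected (T i)" 
      by (rule connected_intermediate_closure[OF a(1)]) (use a(2) i that in \<open>auto simp: T_def\<close>)
    show "p i \<in> closure (T i)"
      using a(2) i that closure_mono[of "I i 5 - {p i, p 5}" "T i"] by (auto simp: T_def)
  qed
  have D: "connected D" unfolding D_def
    by (intro connected_Un T) (auto simp: T_def)
  have TI: "T i \<inter> I k j = {}" if "i < 3" "k < 3" "j \<in> {3,4}" for i j k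
  proof -
    have "I i 5 \<inter> I k j = p ` ({i, 5} \<inter> {k, j})" using that by (intro II) (auto simp: doubleton_eq_iff)
    also have "\<dots> \<subseteq> p ` {i}" by (rule image_mono) (use that in auto)
    finally have "I i 5 \<inter> I k j \<subseteq> {p i}" by simp
    then show ?thesis using pI[of k j 5] that by (auto simp: T_def)
  qed
  then have DJ: "D \<inter> (J 0 \<union> J 1 \<union> J 2) = {}" unfolding D_def J_def by (simp add: Int_Un_distrib Int_Un_distrib2)
  have cl: "(J i - {p 3, p 4}) \<inter> closure D \<noteq> {}" if "i < 3" for i
  proof -
    have "T i \<subseteq> D" using that by (auto simp: D_def less_Suc_eq numeral_eq_Suc)
    then have "p i \<in> closure D" using T(2)[OF that] closure_mono by blast
    moreover have "p i \<in> J i" using pI[of i 3 i] that by (auto simp: J_def)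
    moreover have "p i \<noteq> p 3" "p i \<noteq> p 4" using that by (auto simp: inj_on_eq_iff[OF inj])
    ultimately show ?thesis by blast
  qed
  show False
    by (rule theta_no_tripod[of "p 3" "p 4" "J 0" "J 1" "J 2" D]) (use J JJ D DJ cl in auto)
qed

section \<open>Joining two subdivided edges\<close>

text \<open>In this form connectivity passes from one graph to another by restricting the two sides
  of a cut; no paths have to be rerouted.\<close>

lemma connected_on_iff_no_cut:
  "connected_on W E \<longleftrightarrow>
    (\<forall>X Y. X \<inter> Y = {} \<longrightarrow> X \<union> Y = W \<longrightarrow> (\<forall>u\<in>X. \<forall>v\<in>Y. {u, v} \<notin> E) \<longrightarrow> X = {} \<or> Y = {})"
proof
  assume c: "connected_on W E"
  show "\<forall>X Y. X \<inter> Y = {} \<longrightarrow> X \<union> Y = W \<longrightarrow> (\<forall>u\<in>X. \<forall>v\<in>Y. {u, v} \<notin> E) \<longrightarrow> X = {} \<or> Y = {}"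
  proof (intro allI impI, rule ccontr)
    fix X Y assume *: "X \<inter> Y = {}" "X \<union> Y = W" "\<forall>u\<in>X. \<forall>v\<in>Y. {u, v} \<notin> E" "\<not> (X = {} \<or> Y = {})"
    then obtain u v where uv: "u \<in> X" "v \<in> Y" by auto
    then have "(u, v) \<in> {(x, y). x \<in> W \<and> y \<in> W \<and> {x, y} \<in> E}\<^sup>*"
      using c *(2) unfolding connected_on_def by auto
    then have "v \<in> X" using uv(1)
      by (induction rule: converse_rtrancl_induct) (use * in auto)
    then show False using uv * by auto
  qed
next
  assume *: "\<forall>X Y. X \<inter> Y = {} \<longrightarrow> X \<union> Y = W \<longrightarrow> (\<forall>u\<in>X. \<forall>v\<in>Y. {u, v} \<notin> E) \<longrightarrow> X = {} \<or> Y = {}"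
  show "connected_on W E" unfolding connected_on_def
  proof (intro ballI)
    fix u v assume uv: "u \<in> W" "v \<in> W"
    let ?R = "{(x, y). x \<in> W \<and> y \<in> W \<and> {x, y} \<in> E}"
    let ?X = "{z \<in> W. (u, z) \<in> ?R\<^sup>*}"
    have "\<forall>s\<in>?X. \<forall>t\<in>W - ?X. {s, t} \<notin> E"
    proof (intro ballI notI)
      fix s t assume "s \<in> ?X" "t \<in> W - ?X" "{s, t} \<in> E"
      then have "(u, s) \<in> ?R\<^sup>*" "(s, t) \<in> ?R" "t \<in> W" "(u, t) \<notin> ?R\<^sup>*" by auto
      then show False by (meson rtrancl.rtrancl_into_rtrancl)
    qed
    then have "?X = {} \<or> W - ?X = {}" using *[rule_format, of ?X "W - ?X"] by blast
    moreover have "u \<in> ?X" using uv by simp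
    ultimately show "(u, v) \<in> ?R\<^sup>*" using uv by blast
  qed
qed

lemma k_connected_iff_no_cut:
  "k_connected k V E \<longleftrightarrow> k < card V \<and>
    (\<forall>S X Y. S \<subseteq> V \<longrightarrow> card S < k \<longrightarrow> X \<inter> Y = {} \<longrightarrow> X \<union> Y = V - S \<longrightarrow>
      (\<forall>u\<in>X. \<forall>v\<in>Y. {u, v} \<notin> E) \<longrightarrow> X = {} \<or> Y = {})"
  unfolding k_connected_def connected_on_iff_no_cut by blast

text \<open>Deleting vertices may be traded for deleting edges: replace a crossing edge by one of its ends.\<close>
lemma k_connected_mixed_cut:
  assumes "k_connected k V E" "finite V" "finite F"
    and "card T + card F < k" "T \<subseteq> V" "X \<inter> Y = {}" "X \<union> Y = V - T"
    and "\<And>u v. u \<in> X \<Longrightarrow> v \<in> Y \<Longrightarrow> {u, v} \<in> E \<Longrightarrow> {u, v} \<in> F"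
  shows "X = {} \<or> Y = {}"
  using assms(3-)
proof (induction F arbitrary: T X Y rule: finite_induct)
  case empty
  then show ?case using assms(1) unfolding k_connected_iff_no_cut by (metis add.right_neutral card.empty empty_iff)
next
  case (insert e F)
  have fT: "finite T" using insert.prems(2) assms(2) finite_subset by blast
  show ?case
  proof (rule ccontr)
    assume ne: "\<not> (X = {} \<or> Y = {})"
    show False
    proof (cases "\<exists>p\<in>X. \<exists>q\<in>Y. e = {p, q}")
      case False
      then have "\<And>u v. u \<in> X \<Longrightarrow> v \<in> Y \<Longrightarrow> {u, v} \<in> E \<Longrightarrow> {u, v} \<in> F"
        using insert.prems(5) by blast
      then show False using insert.IH[of T X Y] insert.prems insert.hyps ne by simp
    next
      case True
      then obtain p q where pq: "p \<in> X" "q \<in> Y" "e = {p, q}" by blast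
      have "p \<in> V - T" "q \<in> V - T" using pq insert.prems(4) by blast+
      then have ct: "card (insert p T) = Suc (card T)" "card (insert q T) = Suc (card T)" "insert p T \<subseteq> V" "insert q T \<subseteq> V"
        using fT insert.prems(2) by auto
      have c: "card T + Suc (card F) < k" using insert.prems(1) insert.hyps by simp
      have "X - {p} = {} \<or> Y = {}"
      proof (rule insert.IH[of "insert p T"])
        fix u v assume uv: "u \<in> X - {p}" "v \<in> Y" "{u, v} \<in> E"
        then have "{u, v} \<noteq> e" using pq insert.prems(3) by (auto simp: doubleton_eq_iff)
        then show "{u, v} \<in> F" using insert.prems(5)[of u v] uv by blast
      qed (use ct c insert.prems pq in auto)
      moreover have "X = {} \<or> Y - {q} = {}"
      proof (rule insert.IH[of "insert q T"])
        fix u v assume uv: "u \<in> X" "v \<in> Y - {q}" "{u, v} \<in> E"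
        then have "{u, v} \<noteq> e" using pq insert.prems(3) by (auto simp: doubleton_eq_iff)
        then show "{u, v} \<in> F" using insert.prems(5)[of u v] uv by blast
      qed (use ct c insert.prems pq in auto)
      \<comment> \<open>If neither end of the crossing edge can be traded for it, the sides are
        single vertices. Then there are at most \<open>card T + 2\<close> vertices, which is at most
        \<open>k\<close>, against \<open>card V > k\<close>.\<close>
      ultimately have "X = {p}" "Y = {q}" using ne pq by auto
      then have "V = insert p (insert q T)" using insert.prems(2,4) by blast
      then have "card V \<le> Suc (Suc (card T))" using fT by (metis card_insert_le_m1 card_insert_if finite_insert le_SucI order_refl)
      then show False using c assms(1) unfolding k_connected_def by linarith
    qed
  qed
qed

section \<open>Inserting a rung: degrees, planarity and 3-connectivity\<close>

definition h_insert :: "'v \<Rightarrow> 'v \<Rightarrow> 'v \<Rightarrow> 'v \<Rightarrow> 'v \<Rightarrow> 'v \<Rightarrow> 'v set set \<Rightarrow> 'v set set" where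
  "h_insert a b c d x y E = {{a,x},{x,b},{c,y},{y,d},{x,y}} \<union> (E - {{a,b},{c,d}})"

text \<open>The two subdivided edges must be different but may share an end; \<open>E18\<close> is
  built with such insertions at vertex 0.\<close>

locale h_insertion =
  fixes V :: "'v set" and E :: "'v set set" and a b c d x y :: 'v
  assumes simple: "simple_graph V E"
    and ab: "{a, b} \<in> E" and cd: "{c, d} \<in> E" and abcd: "{a, b} \<noteq> {c, d}"
    and xV: "x \<notin> V" and yV: "y \<notin> V" and xy: "x \<noteq> y"
begin

abbreviation "V' \<equiv> insert x (insert y V)"
abbreviation "E' \<equiv> h_insert a b c d x y E"

lemma edges: "e \<in> E \<Longrightarrow> e \<subseteq> V" and edges_card: "e \<in> E \<Longrightarrow> card e = 2" and finV: "finite V"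
  using simple unfolding simple_graph_def by auto

lemma ends: "a \<in> V" "b \<in> V" "c \<in> V" "d \<in> V" "a \<noteq> b" "c \<noteq> d"
  using edges[OF ab] edges[OF cd] edges_card[OF ab] edges_card[OF cd] by auto

lemma fresh: "a \<noteq> x" "b \<noteq> x" "c \<noteq> x" "d \<noteq> x" "a \<noteq> y" "b \<noteq> y" "c \<noteq> y" "d \<noteq> y"
  using ends xV yV by auto

lemma simple': "simple_graph V' E'"
  using simple ends fresh xy unfolding simple_graph_def h_insert_def by auto

lemma incident_new: "{e \<in> E'. x \<in> e} = {{a,x},{x,b},{x,y}}" "{e \<in> E'. y \<in> e} = {{c,y},{y,d},{x,y}}"
  using edges xV yV fresh xy by (auto simp: h_insert_def)

text \<open>Subdividing only shortens an edge at \<open>v\<close>. Written as the image under an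
  explicit map, the incidence set keeps its size as soon as that map is injective.\<close>

lemma incident_old: 
  assumes "v \<in> V"
  shows "{e \<in> E'. v \<in> e} = (\<lambda>e. if e = {a, b} then {v, x} else if e = {c, d} then {v, y} else e) ` {e \<in> E. v \<in> e}" (is "?L = ?f ` ?R")
proof
  have v: "v \<noteq> x" "v \<noteq> y" using assms xV yV by auto
  show "?f ` ?R \<subseteq> ?L" using v by (auto simp: h_insert_def)
  show "?L \<subseteq> ?f ` ?R"
  proof
    fix e assume e: "e \<in> ?L"
    then consider "e = {v, x}" "v \<in> {a, b}" | "e = {v, y}" "v \<in> {c, d}" | "e \<in> E - {{a, b}, {c, d}}" "v \<in> e"
      using v by (auto simp: h_insert_def)
    then show "e \<in> ?f ` ?R"
    proof cases
      case 1 then show ?thesis using ab by (intro image_eqI[of _ _ "{a, b}"]) auto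
    next
      case 2 then show ?thesis using cd abcd by (intro image_eqI[of _ _ "{c, d}"]) auto
    next
      case 3 then show ?thesis by (intro image_eqI[of _ _ e]) auto
    qed
  qed
qed

lemma cubic': assumes "cubic V E" shows "cubic V' E'"
  unfolding cubic_def
proof
  fix v assume "v \<in> V'"
  then consider "v = x" | "v = y" | "v \<in> V" by auto
  then show "card {e \<in> E'. v \<in> e} = 3"
  proof cases
    case 1 then show ?thesis using incident_new fresh xy ends by (simp add: doubleton_eq_iff)
  next
    case 2 then show ?thesis using incident_new fresh xy ends by (simp add: doubleton_eq_iff)
  next
    case 3
    have inj: "inj_on (\<lambda>e. if e = {a, b} then {v, x} else if e = {c, d} then {v, y} else e) {e \<in> E. v \<in> e}"
      using edges xV yV xy 3 by (auto simp: inj_on_def doubleton_eq_iff split: if_splits)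
    show ?thesis unfolding incident_old[OF 3] card_image[OF inj] using assms 3 by (simp add: cubic_def)
  qed
qed

text \<open>Without the edge \<open>{x, y}\<close> the new graph is a subdivision of the old one,
  and \<open>x\<close> and \<open>y\<close> can be smoothed one after the other.\<close>

lemma planar_h_insert: assumes "planar V' E'" shows "planar V E"
proof -
  let ?E0 = "E - {{a, b}, {c, d}}"
  have E0: "\<And>e. e \<in> ?E0 \<Longrightarrow> e \<subseteq> V" using edges by auto
  have "planar V' (insert {a, x} (insert {x, b} (insert {c, y} (insert {y, d} ?E0))))"
    by (rule planar_mono[OF assms]) (use ends E0 in \<open>auto simp: h_insert_def\<close>)
  then have "planar (insert y V) (insert {a, b} (insert {c, y} (insert {y, d} ?E0)))"
    by (rule planar_smooth) (use ends xV xy E0 in auto)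
  then have "planar (insert y V) (insert {c, y} (insert {y, d} (insert {a, b} ?E0)))"
    by (simp add: insert_commute)
  then have "planar V (insert {c, d} (insert {a, b} ?E0))"
    by (rule planar_smooth) (use ends yV E0 in auto)
  moreover have "insert {c, d} (insert {a, b} ?E0) = E" using ab cd by auto
  ultimately show ?thesis by simp
qed

text \<open>A small separator \<open>S\<close> of the new graph becomes a mixed one of the old
  graph: old vertices stay deleted, and a new vertex in \<open>S\<close> is replaced by the edge it
  subdivides. So one side contains no old vertex.\<close>

lemma three_connected': assumes con: "k_connected 3 V E" shows "k_connected 3 V' E'"
  unfolding k_connected_iff_no_cut
proof (intro conjI allI impI)
  have "3 < card V" using con by (simp add: k_connected_def)
  then show "3 < card V'" using finV xV yV xy by simp
next
  \<comment> \<open>A side made of new vertices only has all its other neighbors in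
    \<open>S\<close>. For \<open>x\<close> alone these are the three vertices \<open>a\<close>,
    \<open>b\<close>, \<open>y\<close>, and similarly for \<open>y\<close>; for both,
    \<open>S\<close> would equal \<open>{a, b}\<close> and \<open>{c, d}\<close>.\<close>
  have main: False if S: "S \<subseteq> V'" "card S < 3" and XY: "X \<inter> Y = {}" "X \<union> Y = V' - S" 
      and no: "\<forall>u\<in>X. \<forall>v\<in>Y. {u, v} \<notin> E'" and X: "X \<inter> V = {}" "X \<noteq> {}" for S X Y
  proof -
    have no1: "u \<in> X \<Longrightarrow> {u, v} \<in> E' \<Longrightarrow> v \<in> V' \<Longrightarrow> v \<in> X \<or> v \<in> S" for u v
      using no XY by blast
    have fS: "finite S" using S finV finite_subset by blast
    have E': "{x, a} \<in> E'" "{x, b} \<in> E'" "{y, c} \<in> E'" "{y, d} \<in> E'" "{x, y} \<in> E'" "{y, x} \<in> E'" 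
      by (auto simp: h_insert_def insert_commute)
    have x: "x \<in> X \<Longrightarrow> a \<in> S \<and> b \<in> S \<and> (y \<in> X \<or> y \<in> S)"
      using no1[OF _ E'(1)] no1[OF _ E'(2)] no1[OF _ E'(5)] ends X by auto
    have y: "y \<in> X \<Longrightarrow> c \<in> S \<and> d \<in> S \<and> (x \<in> X \<or> x \<in> S)"
      using no1[OF _ E'(3)] no1[OF _ E'(4)] no1[OF _ E'(6)] ends X by auto
    have no3: "card M \<noteq> 3" if "M \<subseteq> S" for M using card_mono[OF fS that] S by linarith
    have "X \<subseteq> V'" using XY by blast
    then have "x \<in> X \<or> y \<in> X" using X by blast
    moreover have False if "x \<in> X" "y \<in> X"
    proof -
      have "{a, b} \<subseteq> S" "{c, d} \<subseteq> S" using x y that by auto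
      moreover have "card S \<le> card {a, b}" "card S \<le> card {c, d}" using S ends by auto
      ultimately have "{a, b} = S" "{c, d} = S" using fS by (meson card_seteq)+
      then show False using abcd by simp
    qed
    moreover have False if "x \<in> X" "y \<notin> X"
      using x[OF that(1)] that no3[of "{a, b, y}"] ends fresh by auto
    moreover have False if "y \<in> X" "x \<notin> X"
      using y[OF that(1)] that no3[of "{c, d, x}"] ends fresh by auto
    ultimately show False by blast
  qed
  fix S X Y
  assume S: "S \<subseteq> V'" "card S < 3" and XY: "X \<inter> Y = {}" "X \<union> Y = V' - S" 
      and no: "\<forall>u\<in>X. \<forall>v\<in>Y. {u, v} \<notin> E'"
  have fS: "finite S" using S finV finite_subset by blast
  define F where "F = (if x \<in> S then {{a, b}} else {}) \<union> (if y \<in> S then {{c, d}} else {})"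
  have fF: "finite F" by (simp add: F_def)
  have ca: "card (S \<inter> V) + card F < 3"
  proof -
    have "card F \<le> card (S \<inter> {x, y})" using xy by (auto simp: F_def card_insert_if)
    moreover have "card (S \<inter> V) + card (S \<inter> {x, y}) = card ((S \<inter> V) \<union> (S \<inter> {x, y}))"
      by (rule card_Un_disjoint[symmetric]) (use fS xV yV in auto)
    moreover have "\<dots> \<le> card S" by (rule card_mono) (use fS in auto)
    ultimately show ?thesis using S by linarith
  qed
  have "X \<inter> V = {} \<or> Y \<inter> V = {}"
  proof (rule k_connected_mixed_cut[OF con finV fF ca])
    show "S \<inter> V \<subseteq> V" "X \<inter> V \<inter> (Y \<inter> V) = {}" using XY by auto
    show "X \<inter> V \<union> Y \<inter> V = V - S \<inter> V" using XY xV yV by blast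
    fix u v assume uv: "u \<in> X \<inter> V" "v \<in> Y \<inter> V" "{u, v} \<in> E"
    then have "{u, v} \<notin> E'" using no by auto
    then have "{u, v} \<in> {{a, b}, {c, d}}" using uv(3) by (auto simp: h_insert_def)
    moreover have "x \<in> S" if "{u, v} = {a, b}"
    proof (rule ccontr)
      assume "x \<notin> S"
      then have "x \<in> X \<or> x \<in> Y" using XY by blast
      moreover have "{u, x} \<in> E'" "{x, v} \<in> E'" using that by (auto simp: h_insert_def doubleton_eq_iff insert_commute)
      ultimately show False using no uv by auto
    qed
    moreover have "y \<in> S" if "{u, v} = {c, d}"
    proof (rule ccontr)
      assume "y \<notin> S"
      then have "y \<in> X \<or> y \<in> Y" using XY by blast
      moreover have "{u, y} \<in> E'" "{y, v} \<in> E'" using that by (auto simp: h_insert_def doubleton_eq_iff insert_commute)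
      ultimately show False using no uv by auto
    qed
    ultimately show "{u, v} \<in> F" by (auto simp: F_def)
  qed
  moreover have "X = {}" if "X \<inter> V = {}" using main[OF S XY no that] by blast
  moreover have "Y = {}" if "Y \<inter> V = {}"
  proof -
    have "\<forall>u\<in>Y. \<forall>v\<in>X. {u, v} \<notin> E'" using no by (metis insert_commute)
    then show ?thesis using main[OF S, of Y X] XY that by (metis Int_commute Un_commute)
  qed
  ultimately show "X = {} \<or> Y = {}" by blast
qed

end

lemma Collect_insert_conj: "{e \<in> insert A B. P e} = (if P A then insert A else id) {e \<in> B. P e}"
  by auto

text \<open>Collects the properties preserved by one insertion; bipartiteness is left out because it
  is restored only by a second one.\<close>

definition nonplanar_cubic :: "'v set \<Rightarrow> 'v set set \<Rightarrow> bool" where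
  "nonplanar_cubic V E \<longleftrightarrow> simple_graph V E \<and> cubic V E \<and> k_connected 3 V E \<and> \<not> planar V E"

lemma nonplanar_cubic_h_insert:
  assumes "nonplanar_cubic V E" "{a, b} \<in> E" "{c, d} \<in> E" "{a, b} \<noteq> {c, d}" "x \<notin> V" "y \<notin> V" "x \<noteq> y"
  shows "nonplanar_cubic (insert x (insert y V)) (h_insert a b c d x y E)"
proof -
  interpret h_insertion V E a b c d x y using assms by unfold_locales (auto simp: nonplanar_cubic_def)
  show ?thesis using assms(1) simple' cubic' three_connected' planar_h_insert by (auto simp: nonplanar_cubic_def)
qed

lemma nonplanar_cubic_K33: "nonplanar_cubic {0..<6} K33"
proof -
  have V: "{0..<6} = {0,1,2,3,4,5::nat}" by auto
  have s: "simple_graph {0..<6} K33" by (auto simp: simple_graph_def K33_def)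
  have "cubic {0..<6} K33" unfolding cubic_def 
  proof
    fix v :: nat assume "v \<in> {0..<6}"
    then have v: "v \<in> {0,1,2,3,4,5}" unfolding V .
    then show "card {e \<in> K33. v \<in> e} = 3" unfolding K33_def Collect_insert_conj 
      by (elim insertE emptyE) (simp_all add: doubleton_eq_iff)
  qed
  moreover have "k_connected 3 {0..<6} K33" unfolding k_connected_iff_no_cut
  proof (intro conjI allI impI, simp)
    fix S X Y :: "nat set" 
    assume S: "S \<subseteq> {0..<6}" "card S < 3" and XY: "X \<inter> Y = {}" "X \<union> Y = {0..<6} - S" 
      and no: "\<forall>u\<in>X. \<forall>v\<in>Y. {u, v} \<notin> K33"
    have fS: "finite S" using S finite_subset by blast
    have no3: "\<not> M \<subseteq> S" if "card M = 3" for M using card_mono[OF fS, of M] S that by linarith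
    \<comment> \<open>One vertex of each part survives, and every surviving vertex is adjacent to
      \<open>i\<close> or to \<open>j\<close>, which are adjacent to each other.\<close>
    obtain i where i: "i \<in> {0,1,2}" "i \<notin> S" using no3[of "{0,1,2}"] by auto
    obtain j where j: "j \<in> {3,4,5}" "j \<notin> S" using no3[of "{3,4,5}"] by auto
    have ed: "u < 3 \<Longrightarrow> v \<in> {3,4,5} \<Longrightarrow> {u, v} \<in> K33 \<and> {v, u} \<in> K33" for u v 
      using K33_edge by (simp add: insert_commute)
    have in1: "u \<in> X \<or> u \<in> Y" if "u < 6" "u \<notin> S" for u using XY that by auto
    have nox: "(u \<in> X \<longleftrightarrow> v \<in> X)" if "u < 3" "v \<in> {3,4,5}" "u \<notin> S" "v \<notin> S" for u v
      using in1[of u] in1[of v] that no ed[of u v] XY(1) by auto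
    have split: "u < 3 \<or> u \<in> {3,4,5}" if "u < 6" for u :: nat using that by auto
    have "u \<in> X \<longleftrightarrow> i \<in> X" if "u < 6" "u \<notin> S" for u
    proof -
      have "i < 3" using i by auto
      then show ?thesis using split[OF that(1)] nox[of u j] nox[of i j] nox[of i u] i j that by blast
    qed
    moreover have "\<forall>u\<in>X \<union> Y. u < 6 \<and> u \<notin> S" unfolding XY(2) by simp
    ultimately have "X = {} \<or> Y \<subseteq> X" by blast
    then show "X = {} \<or> Y = {}" using XY by blast
  qed
  ultimately show ?thesis using s K33_nonplanar by (simp add: nonplanar_cubic_def)
qed

section \<open>Colorings that share a color class\<close>

lemma properD:
  assumes "proper_3_edge_coloring E c"
  shows "e \<in> E \<Longrightarrow> c e \<in> {1, 2, 3}" "e \<notin> E \<Longrightarrow> c e = 0"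
    "e \<in> E \<Longrightarrow> f \<in> E \<Longrightarrow> e \<noteq> f \<Longrightarrow> e \<inter> f \<noteq> {} \<Longrightarrow> c e \<noteq> c f"
proof -
  note p = assms[unfolded proper_3_edge_coloring_def]
  show "e \<in> E \<Longrightarrow> c e \<in> {1, 2, 3}" by (rule bspec[OF conjunct1[OF p]])
  show "e \<notin> E \<Longrightarrow> c e = 0" using conjunct1[OF conjunct2[OF p]] by simp
  show "e \<in> E \<Longrightarrow> f \<in> E \<Longrightarrow> e \<noteq> f \<Longrightarrow> e \<inter> f \<noteq> {} \<Longrightarrow> c e \<noteq> c f"
    using conjunct2[OF conjunct2[OF p]] by simp
qed

definition share_class :: "'v set set \<Rightarrow> (('v set \<Rightarrow> nat) \<times> ('v set \<Rightarrow> nat)) set" where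
  "share_class E = {(c, d). proper_3_edge_coloring E c \<and> proper_3_edge_coloring E d \<and>
     (\<exists>y\<in>{1, 2, 3}. \<forall>e\<in>E. c e = y \<longleftrightarrow> d e = y)}"

text \<open>Two colorings that share a color class differ by switching some of the chains of the other two colors.\<close>
lemma kempe_equivalent_if_share_class:
  assumes "finite E" "(c, d) \<in> share_class E"
  shows "(c, d) \<in> (kempe_step E \<union> (kempe_step E)\<inverse>)\<^sup>*"
proof -
  obtain y where y: "y \<in> {1, 2, 3}" and "\<forall>e\<in>E. c e = y \<longleftrightarrow> d e = y"
    and pc: "proper_3_edge_coloring E c" and pd: "proper_3_edge_coloring E d"
    using assms(2) unfolding share_class_def by auto
  then show ?thesis
  proof (induction "card {e \<in> E. c e \<noteq> d e}" arbitrary: c rule: less_induct)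
    case less
    note sh = less.prems(2) and pc = less.prems(3)
    show ?case
    proof (cases "{e \<in> E. c e \<noteq> d e} = {}")
      case True
      have "c x = d x" for x
        by (cases "x \<in> E") (use True properD(2)[OF pc] properD(2)[OF pd] in auto)
      then have "c = d" by (rule ext)
      then show ?thesis by simp
    next
      case False
      then obtain e where e: "e \<in> E" "c e \<noteq> d e" by auto
      define a b where "a = c e" and "b = d e"
      have abc: "a \<in> {1, 2, 3}" "b \<in> {1, 2, 3}" "a \<noteq> b" "a \<noteq> y" "b \<noteq> y"
        using properD(1)[OF pc e(1)] properD(1)[OF pd e(1)] e sh by (auto simp: a_def b_def)
      have other: "z \<in> {a, b}" if "z \<in> {1, 2, 3}" "z \<noteq> y" for z using abc y that by auto
      define R where "R = {(x, z). x \<in> E \<and> z \<in> E \<and> c x \<in> {a, b} \<and> c z \<in> {a, b} \<and> x \<inter> z \<noteq> {}}"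
      define C where "C = R\<^sup>* `` {e}"
      have chain: "kempe_chain E c a b C"
        unfolding kempe_chain_def C_def R_def using e by (intro bexI[of _ e]) (auto simp: a_def)
      \<comment> \<open>Since the class of \<open>y\<close> is common, \<open>d\<close> also uses
        only \<open>a\<close> and \<open>b\<close> on the chain. Both colorings alternate along it
        and differ at \<open>e\<close>, hence they differ on all of it, and switching
        \<open>C\<close> turns \<open>c\<close> into \<open>d\<close> there.\<close>
      have C: "x \<in> E \<and> c x \<in> {a, b} \<and> d x \<in> {a, b} \<and> c x \<noteq> d x" if "x \<in> C" for x
      proof -
        from that have "(e, x) \<in> R\<^sup>*" by (simp add: C_def)
        then show ?thesis
        proof (induction rule: rtrancl_induct)
          case base
          then show ?case using e by (simp add: a_def b_def)
        next
          case (step x z)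
          show ?case
          proof (cases "x = z")
            case False
            have xz: "x \<in> E" "z \<in> E" "c x \<in> {a, b}" "c z \<in> {a, b}" "x \<inter> z \<noteq> {}" using step(2) by (auto simp: R_def)
            have "c z \<noteq> y" using xz abc by auto
            then have "d z \<in> {a, b}" using other[OF properD(1)[OF pd]] xz sh by auto
            then show ?thesis
              using xz properD(3)[OF pc xz(1,2) False xz(5)] properD(3)[OF pd xz(1,2) False xz(5)] step(3) by auto
          qed (use step in simp)
        qed
      qed
      define c' where "c' = kempe_switch c a b C"
      have c'C: "c' x = d x" if "x \<in> C" for x using C[OF that] that abc by (auto simp: c'_def kempe_switch_def)
      have c'n: "c' x = c x" if "x \<notin> C" for x using that by (simp add: c'_def kempe_switch_def)
      have closed: "z \<in> C" if "x \<in> C" "z \<in> E" "c z \<in> {a, b}" "x \<inter> z \<noteq> {}" for x z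
      proof -
        have "(x, z) \<in> R" using that C[OF that(1)] by (auto simp: R_def)
        then show ?thesis using that(1) unfolding C_def by (auto intro: rtrancl_into_rtrancl)
      qed
      \<comment> \<open>\<open>c'\<close> is \<open>d\<close> on the chain and \<open>c\<close> off
        it; an edge off the chain that meets it has neither color \<open>a\<close> nor
        \<open>b\<close>, as the chain is closed under adjacency.\<close>
      have pc': "proper_3_edge_coloring E c'" unfolding proper_3_edge_coloring_def
      proof (intro conjI ballI allI impI)
        fix x assume "x \<in> E" then show "c' x \<in> {1, 2, 3}"
          using c'C c'n properD(1)[OF pc] properD(1)[OF pd] by (cases "x \<in> C") auto
      next
        fix x assume "x \<notin> E" then show "c' x = 0" using C c'n properD(2)[OF pc] by metis
      next
        fix x z assume xz: "x \<in> E" "z \<in> E" "x \<noteq> z \<and> x \<inter> z \<noteq> {}"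
        have *: "c' x \<noteq> c' z" if "x \<in> C" "z \<notin> C" "x \<in> E" "z \<in> E" "x \<inter> z \<noteq> {}" for x z
          using c'C[OF that(1)] c'n[OF that(2)] C[OF that(1)] closed[OF that(1,4) _ that(5)] that(2) by auto
        show "c' x \<noteq> c' z"
        proof (cases "x \<in> C")
          case True
          show ?thesis
          proof (cases "z \<in> C")
            case True
            then show ?thesis using \<open>x \<in> C\<close> c'C properD(3)[OF pd] xz by simp
          qed (use * \<open>x \<in> C\<close> xz in auto)
        next
          case False
          show ?thesis
          proof (cases "z \<in> C")
            case True
            then show ?thesis using *[of z x] False xz by (metis Int_commute)
          qed (use c'n False properD(3)[OF pc] xz in auto)
        qed
      qed
      have "(c, c') \<in> kempe_step E"
        unfolding kempe_step_def using pc chain abc c'_def by auto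
      moreover have "(c', d) \<in> (kempe_step E \<union> (kempe_step E)\<inverse>)\<^sup>*"
      proof (rule less.hyps[OF _ less.prems(1) _ pc' pd])
        show "\<forall>e\<in>E. (c' e = y) = (d e = y)" using sh c'C c'n by metis
        have "{e \<in> E. c' e \<noteq> d e} \<subset> {e \<in> E. c e \<noteq> d e}"
        proof
          show "{e \<in> E. c' e \<noteq> d e} \<subseteq> {e \<in> E. c e \<noteq> d e}" using c'C c'n by force
          have "e \<in> C" by (simp add: C_def)
          then show "{e \<in> E. c' e \<noteq> d e} \<noteq> {e \<in> E. c e \<noteq> d e}" using c'C e by auto
        qed
        then show "card {e \<in> E. c' e \<noteq> d e} < card {e \<in> E. c e \<noteq> d e}"
          using assms(1) by (intro psubset_card_mono) auto
      qed
      ultimately show ?thesis by (meson UnI1 converse_rtrancl_into_rtrancl)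
    qed
  qed
qed

text \<open>Existence is included because without any coloring the number of classes would be
  0.\<close>

definition linked :: "'v set set \<Rightarrow> bool" where
  "linked E \<longleftrightarrow> (\<exists>c. proper_3_edge_coloring E c) \<and>
    (\<forall>c d. proper_3_edge_coloring E c \<longrightarrow> proper_3_edge_coloring E d \<longrightarrow> (c, d) \<in> (share_class E)\<^sup>*)"

lemma edge_kempe_classes_linked:
  assumes "finite E" "linked E"
  shows "edge_kempe_classes E = 1"
proof -
  let ?K = "(kempe_step E \<union> (kempe_step E)\<inverse>)\<^sup>*" and ?P = "{c. proper_3_edge_coloring E c}"
  have sub: "(share_class E)\<^sup>* \<subseteq> ?K"
    using kempe_equivalent_if_share_class[OF assms(1)] by (intro rtrancl_subset_rtrancl) auto
  have "sym ?K" by (intro sym_rtrancl sym_Un_converse)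
  then have eq: "?K `` {c} = ?K `` {d}" if "c \<in> ?P" "d \<in> ?P" for c d
  proof -
    have "(c, d) \<in> ?K" "(d, c) \<in> ?K" using that assms(2) sub unfolding linked_def by auto
    then show ?thesis by (auto intro: rtrancl_trans)
  qed
  obtain c where c: "c \<in> ?P" using assms(2) unfolding linked_def by auto
  have "?P // ?K = {?K `` {c}}" using c eq unfolding quotient_def by blast
  then show ?thesis unfolding edge_kempe_classes_def by simp
qed

lemma sym_share_class: "sym (share_class E)"
  unfolding share_class_def sym_def by auto

section \<open>Strips of four rungs\<close>

text \<open>Turns the condition at a cubic vertex into a linear equation, so that colors propagate
  along a ladder by arithmetic and the third color is \<open>6 - x - y\<close>.\<close>

lemma sum_three_colors:
  fixes x y z :: nat
  assumes "x \<in> {1, 2, 3}" "y \<in> {1, 2, 3}" "z \<in> {1, 2, 3}" "x \<noteq> y" "x \<noteq> z" "y \<noteq> z"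
  shows "x + y + z = 6"
  using assms by (elim insertE emptyE) simp_all

lemma proper_sum:
  assumes "proper_3_edge_coloring E c" "{e \<in> E. v \<in> e} = {e1, e2, e3}" "distinct [e1, e2, e3]"
  shows "c e1 + c e2 + c e3 = 6"
proof (rule sum_three_colors)
  have "e \<in> E \<and> v \<in> e" if "e \<in> {e1, e2, e3}" for e using that assms(2) by blast
  then have e: "e1 \<in> E" "e2 \<in> E" "e3 \<in> E" "v \<in> e1" "v \<in> e2" "v \<in> e3" by simp_all
  show "c e1 \<in> {1, 2, 3}" "c e2 \<in> {1, 2, 3}" "c e3 \<in> {1, 2, 3}" using e properD(1)[OF assms(1)] by blast+
  have "e1 \<inter> e2 \<noteq> {}" "e1 \<inter> e3 \<noteq> {}" "e2 \<inter> e3 \<noteq> {}" using e by blast+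
  then show "c e1 \<noteq> c e2" "c e1 \<noteq> c e3" "c e2 \<noteq> c e3" using e properD(3)[OF assms(1)] assms(3) by auto
qed

lemma properI_incident:
  assumes "\<And>e. e \<in> E \<Longrightarrow> c e \<in> {1, 2, 3}" "\<And>e. e \<notin> E \<Longrightarrow> c e = 0" "\<And>v. inj_on c {e \<in> E. v \<in> e}"
  shows "proper_3_edge_coloring E c"
  unfolding proper_3_edge_coloring_def
proof (intro conjI ballI allI impI)
  fix e f assume ef: "e \<in> E" "f \<in> E" "e \<noteq> f \<and> e \<inter> f \<noteq> {}"
  then obtain v where "v \<in> e" "v \<in> f" by blast
  then show "c e \<noteq> c f" using assms(3)[of v] ef unfolding inj_on_def by blast
qed (use assms in blast)+

lemma third_color:
  assumes "x \<in> {1, 2, 3::nat}" "y \<in> {1, 2, 3}" "x \<noteq> y"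
  shows "6 - x - y \<in> {1, 2, 3}" "6 - x - y \<noteq> x" "6 - x - y \<noteq> y"
  using assms by (elim insertE emptyE; simp)+

lemma inj_on_three: "f x \<noteq> f y \<Longrightarrow> f x \<noteq> f z \<Longrightarrow> f y \<noteq> f z \<Longrightarrow> inj_on f {x, y, z}"
  by (auto simp: inj_on_def)

text \<open>A strip of four rungs whose two rails carry equal colors is determined by the walk
  of rail colors; the color of a rung is the third color.\<close>
definition walk :: "nat \<Rightarrow> nat \<Rightarrow> nat \<Rightarrow> nat \<Rightarrow> nat \<Rightarrow> bool" where
  "walk d0 d1 d2 d3 d4 \<longleftrightarrow> {d0, d1, d2, d3, d4} \<subseteq> {1, 2, 3} \<and> d0 \<noteq> d1 \<and> d1 \<noteq> d2 \<and> d2 \<noteq> d3 \<and> d3 \<noteq> d4"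

text \<open>\<open>share_class\<close> read off on a strip with fixed outer colors: the color
  \<open>y\<close> must sit on the same inner rail edges and on the same four rungs.\<close>

definition walks_share :: "nat \<Rightarrow> nat \<Rightarrow> nat \<times> nat \<times> nat \<Rightarrow> nat \<times> nat \<times> nat \<Rightarrow> bool" where
  "walks_share d0 d4 = (\<lambda>(d1, d2, d3) (d1', d2', d3'). walk d0 d1 d2 d3 d4 \<and> walk d0 d1' d2' d3' d4 \<and>
    (\<exists>y\<in>{1, 2, 3}. (d1 = y \<longleftrightarrow> d1' = y) \<and> (d2 = y \<longleftrightarrow> d2' = y) \<and> (d3 = y \<longleftrightarrow> d3' = y) \<and>
      (6 - d0 - d1 = y \<longleftrightarrow> 6 - d0 - d1' = y) \<and> (6 - d1 - d2 = y \<longleftrightarrow> 6 - d1' - d2' = y) \<and>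
      (6 - d2 - d3 = y \<longleftrightarrow> 6 - d2' - d3' = y) \<and> (6 - d3 - d4 = y \<longleftrightarrow> 6 - d3' - d4 = y)))"

text \<open>
  Two moves suffice: reversing a detour \<open>v p v\<close> to \<open>v u v\<close>, and reversing a full turn \<open>u p v u\<close> to \<open>u v p u\<close>,
  which switches a 6-cycle.
\<close>
lemma walk_to_backtrack:
  assumes "walk d0 d1 d2 d3 d4"
  obtains d1' d2' d3' where "(walks_share d0 d4)\<^sup>*\<^sup>* (d1, d2, d3) (d1', d2', d3')" "walk d0 d1' d2' d3' d4" "d2' = d4"
proof -
  have col: "d0 \<in> {1, 2, 3}" "d1 \<in> {1, 2, 3}" "d2 \<in> {1, 2, 3}" "d3 \<in> {1, 2, 3}" "d4 \<in> {1, 2, 3}"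
    and ne: "d0 \<noteq> d1" "d1 \<noteq> d2" "d2 \<noteq> d3" "d3 \<noteq> d4"
    using assms unfolding walk_def by simp_all
  \<comment> \<open>In \<open>two\<close> and in \<open>three1\<close> to \<open>three4\<close> the
    common class is the color at which the reversed piece of the walk starts and ends:
    \<open>v\<close>, then \<open>p\<close>, \<open>u\<close>, \<open>v\<close>, \<open>p\<close>.
    Only \<open>three2\<close> reverses a full turn.\<close>
  have two: "walks_share d0 u (v, p, v) (v, u, v)"
    if "d0 \<in> {1, 2, 3}" "p \<in> {1, 2, 3}" "v \<in> {1, 2, 3}" "u \<in> {1, 2, 3}" "p \<noteq> v" "p \<noteq> u" "v \<noteq> u" "d0 \<noteq> v" for p u v
    using that by (elim insertE emptyE) (simp_all add: walks_share_def walk_def)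
  have r: "6 - p - v = u" "6 - v - p = u" "6 - p - u = v" "6 - u - p = v" "6 - u - v = p" "6 - v - u = p"
    if "p + v + u = 6" for p u v :: nat using that by linarith+
  have three1: "walks_share p u (u, p, v) (v, p, v)"
    if "p \<in> {1, 2, 3}" "v \<in> {1, 2, 3}" "u \<in> {1, 2, 3}" "p \<noteq> v" "p \<noteq> u" "v \<noteq> u" for p u v
    unfolding walks_share_def walk_def prod.case r[OF sum_three_colors[OF that]]
    by (intro conjI bexI[of _ p]) (use that in auto)
  have three2: "walks_share v u (u, p, v) (u, v, p)"
    if "p \<in> {1, 2, 3}" "v \<in> {1, 2, 3}" "u \<in> {1, 2, 3}" "p \<noteq> v" "p \<noteq> u" "v \<noteq> u" for p u v
    unfolding walks_share_def walk_def prod.case r[OF sum_three_colors[OF that]]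
    by (intro conjI bexI[of _ u]) (use that in auto)
  have three3: "walks_share v u (u, v, p) (p, v, p)"
    if "p \<in> {1, 2, 3}" "v \<in> {1, 2, 3}" "u \<in> {1, 2, 3}" "p \<noteq> v" "p \<noteq> u" "v \<noteq> u" for p u v
    unfolding walks_share_def walk_def prod.case r[OF sum_three_colors[OF that]]
    by (intro conjI bexI[of _ v]) (use that in auto)
  have three4: "walks_share v u (p, v, p) (p, u, p)"
    if "p \<in> {1, 2, 3}" "v \<in> {1, 2, 3}" "u \<in> {1, 2, 3}" "p \<noteq> v" "p \<noteq> u" "v \<noteq> u" for p u v
    unfolding walks_share_def walk_def prod.case r[OF sum_three_colors[OF that]]
    by (intro conjI bexI[of _ p]) (use that in auto)
  \<comment> \<open>If \<open>d2 \<noteq> d4\<close>, then \<open>d3\<close> is the third color, so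
    \<open>d1\<close> is \<open>d3\<close> or \<open>d4\<close>; in the latter case
    \<open>d0\<close> is \<open>d2\<close> or \<open>d3\<close>. The last case is the walk that
    keeps turning in one direction.\<close>
  consider "d2 = d4" | "d2 \<noteq> d4" "d1 = d3" | "d2 \<noteq> d4" "d1 = d4" "d0 = d2" | "d2 \<noteq> d4" "d1 = d4" "d0 = d3"
    using col ne by auto
  then show ?thesis
  proof cases
    case 1
    then show ?thesis using that[of d1 d2 d3] assms by blast
  next
    case 2
    then have *: "walks_share d0 d4 (d1, d2, d3) (d3, d4, d3)" using two[of d2 d3 d4] col ne by simp
    then have "walk d0 d3 d4 d3 d4" by (simp add: walks_share_def)
    then show ?thesis using that[of d3 d4 d3] * by blast
  next
    case 3
    have 1: "walks_share d0 d4 (d1, d2, d3) (d3, d2, d3)" using three1[of d2 d3 d4] col ne 3 by simp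
    have 2: "walks_share d0 d4 (d3, d2, d3) (d3, d4, d3)" using two[of d2 d3 d4] col ne 3 by simp
    then have "walk d0 d3 d4 d3 d4" by (simp add: walks_share_def)
    moreover have "(walks_share d0 d4)\<^sup>*\<^sup>* (d1, d2, d3) (d3, d4, d3)" using 1 2 by (meson r_into_rtranclp rtranclp_trans)
    ultimately show ?thesis using that[of d3 d4 d3] by blast
  next
    case 4
    have 1: "walks_share d0 d4 (d1, d2, d3) (d4, d3, d2)" using three2[of d2 d3 d4] col ne 4 by simp
    have 2: "walks_share d0 d4 (d4, d3, d2) (d2, d3, d2)" using three3[of d2 d3 d4] col ne 4 by simp
    have 3: "walks_share d0 d4 (d2, d3, d2) (d2, d4, d2)" using three4[of d2 d3 d4] col ne 4 by simp
    then have "walk d0 d2 d4 d2 d4" by (simp add: walks_share_def)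
    moreover have "(walks_share d0 d4)\<^sup>*\<^sup>* (d1, d2, d3) (d2, d4, d2)" using 1 2 3 by (meson r_into_rtranclp rtranclp_trans)
    ultimately show ?thesis using that[of d2 d4 d2] by blast
  qed
qed

locale strip =
  fixes E :: "'v set set" and a0 a1 a2 a3 a4 a5 b0 b1 b2 b3 b4 b5 :: 'v
  assumes inner: "distinct [a1, a2, a3, a4, b1, b2, b3, b4]"
    and outer: "{a0, a5, b0, b5} \<inter> {a1, a2, a3, a4, b1, b2, b3, b4} = {}"
    and inc_a: "{e \<in> E. a1 \<in> e} = {{a0,a1}, {a1,b1}, {a1,a2}}" "{e \<in> E. a2 \<in> e} = {{a1,a2}, {a2,b2}, {a2,a3}}"
      "{e \<in> E. a3 \<in> e} = {{a2,a3}, {a3,b3}, {a3,a4}}" "{e \<in> E. a4 \<in> e} = {{a3,a4}, {a4,b4}, {a4,a5}}"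
    and inc_b: "{e \<in> E. b1 \<in> e} = {{b0,b1}, {a1,b1}, {b1,b2}}" "{e \<in> E. b2 \<in> e} = {{b1,b2}, {a2,b2}, {b2,b3}}"
      "{e \<in> E. b3 \<in> e} = {{b2,b3}, {a3,b3}, {b3,b4}}" "{e \<in> E. b4 \<in> e} = {{b3,b4}, {a4,b4}, {b4,b5}}"
begin

lemma ne: "a1 \<noteq> a2" "a1 \<noteq> a3" "a1 \<noteq> a4" "a2 \<noteq> a3" "a2 \<noteq> a4" "a3 \<noteq> a4"
  "b1 \<noteq> b2" "b1 \<noteq> b3" "b1 \<noteq> b4" "b2 \<noteq> b3" "b2 \<noteq> b4" "b3 \<noteq> b4"
  "a1 \<noteq> b1" "a1 \<noteq> b2" "a1 \<noteq> b3" "a1 \<noteq> b4" "a2 \<noteq> b1" "a2 \<noteq> b2" "a2 \<noteq> b3" "a2 \<noteq> b4"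
  "a3 \<noteq> b1" "a3 \<noteq> b2" "a3 \<noteq> b3" "a3 \<noteq> b4" "a4 \<noteq> b1" "a4 \<noteq> b2" "a4 \<noteq> b3" "a4 \<noteq> b4"
  "a0 \<noteq> a1" "a0 \<noteq> a2" "a0 \<noteq> a3" "a0 \<noteq> a4" "a0 \<noteq> b1" "a0 \<noteq> b2" "a0 \<noteq> b3" "a0 \<noteq> b4"
  "b0 \<noteq> a1" "b0 \<noteq> a2" "b0 \<noteq> a3" "b0 \<noteq> a4" "b0 \<noteq> b1" "b0 \<noteq> b2" "b0 \<noteq> b3" "b0 \<noteq> b4"
  "a5 \<noteq> a1" "a5 \<noteq> a2" "a5 \<noteq> a3" "a5 \<noteq> a4" "a5 \<noteq> b1" "a5 \<noteq> b2" "a5 \<noteq> b3" "a5 \<noteq> b4"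
  "b5 \<noteq> a1" "b5 \<noteq> a2" "b5 \<noteq> a3" "b5 \<noteq> a4" "b5 \<noteq> b1" "b5 \<noteq> b2" "b5 \<noteq> b3" "b5 \<noteq> b4"
  using inner outer by auto

lemmas nes = ne ne[symmetric]

lemma sums:
  assumes "proper_3_edge_coloring E c"
  shows "c {a0,a1} + c {a1,b1} + c {a1,a2} = 6" "c {a1,a2} + c {a2,b2} + c {a2,a3} = 6"
    "c {a2,a3} + c {a3,b3} + c {a3,a4} = 6" "c {a3,a4} + c {a4,b4} + c {a4,a5} = 6"
    "c {b0,b1} + c {a1,b1} + c {b1,b2} = 6" "c {b1,b2} + c {a2,b2} + c {b2,b3} = 6"
    "c {b2,b3} + c {a3,b3} + c {b3,b4} = 6" "c {b3,b4} + c {a4,b4} + c {b4,b5} = 6"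
  by (rule proper_sum[OF assms], rule inc_a inc_b, simp add: doubleton_eq_iff nes)+

lemma strip_edges: "{a0,a1} \<in> E" "{a1,a2} \<in> E" "{a2,a3} \<in> E" "{a3,a4} \<in> E" "{a4,a5} \<in> E"
  "{b0,b1} \<in> E" "{b1,b2} \<in> E" "{b2,b3} \<in> E" "{b3,b4} \<in> E" "{b4,b5} \<in> E"
  "{a1,b1} \<in> E" "{a2,b2} \<in> E" "{a3,b3} \<in> E" "{a4,b4} \<in> E"
  using inc_a[THEN equalityD2] inc_b[THEN equalityD2] by simp_all

definition recolor :: "('v set \<Rightarrow> nat) \<Rightarrow> nat \<times> nat \<times> nat \<Rightarrow> 'v set \<Rightarrow> nat" where
  "recolor c = (\<lambda>(d1, d2, d3). c({a1,a2} := d1, {b1,b2} := d1, {a2,a3} := d2, {b2,b3} := d2, {a3,a4} := d3, {b3,b4} := d3,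
    {a1,b1} := 6 - c {a0,a1} - d1, {a2,b2} := 6 - d1 - d2, {a3,b3} := 6 - d2 - d3, {a4,b4} := 6 - d3 - c {a4,a5}))"

lemma recolor_vals:
  "recolor c (d1, d2, d3) {a0,a1} = c {a0,a1}" "recolor c (d1, d2, d3) {b0,b1} = c {b0,b1}"
  "recolor c (d1, d2, d3) {a4,a5} = c {a4,a5}" "recolor c (d1, d2, d3) {b4,b5} = c {b4,b5}"
  "recolor c (d1, d2, d3) {a1,a2} = d1" "recolor c (d1, d2, d3) {b1,b2} = d1"
  "recolor c (d1, d2, d3) {a2,a3} = d2" "recolor c (d1, d2, d3) {b2,b3} = d2"
  "recolor c (d1, d2, d3) {a3,a4} = d3" "recolor c (d1, d2, d3) {b3,b4} = d3"
  "recolor c (d1, d2, d3) {a1,b1} = 6 - c {a0,a1} - d1" "recolor c (d1, d2, d3) {a2,b2} = 6 - d1 - d2"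
  "recolor c (d1, d2, d3) {a3,b3} = 6 - d2 - d3" "recolor c (d1, d2, d3) {a4,b4} = 6 - d3 - c {a4,a5}"
  by (simp_all add: recolor_def doubleton_eq_iff nes)

lemma recolor_outside:
  assumes "v \<in> e" "v \<notin> {a1, a2, a3, a4, b1, b2, b3, b4}"
  shows "recolor c t e = c e"
proof -
  have "e \<notin> {{a1,a2}, {b1,b2}, {a2,a3}, {b2,b3}, {a3,a4}, {b3,b4}, {a1,b1}, {a2,b2}, {a3,b3}, {a4,b4}}"
    using assms by auto
  then show ?thesis by (cases t) (simp add: recolor_def)
qed

lemma proper_recolor:
  assumes c: "proper_3_edge_coloring E c" and w: "walk (c {a0,a1}) d1 d2 d3 (c {a4,a5})"
    and eq: "c {b0,b1} = c {a0,a1}" "c {b4,b5} = c {a4,a5}"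
  shows "proper_3_edge_coloring E (recolor c (d1, d2, d3))"
proof (rule properI_incident)
  have d: "c {a0,a1} \<in> {1, 2, 3}" "d1 \<in> {1, 2, 3}" "d2 \<in> {1, 2, 3}" "d3 \<in> {1, 2, 3}" "c {a4,a5} \<in> {1, 2, 3}"
      "c {a0,a1} \<noteq> d1" "d1 \<noteq> d2" "d2 \<noteq> d3" "d3 \<noteq> c {a4,a5}"
    using w unfolding walk_def by simp_all
  note t = third_color[OF d(1,2,6)] third_color[OF d(2,3,7)] third_color[OF d(3,4,8)] third_color[OF d(4,5,9)]
  fix e
  show "recolor c (d1, d2, d3) e \<in> {1, 2, 3}" if "e \<in> E"
    using properD(1)[OF c that] d t unfolding recolor_def by (simp del: One_nat_def)
  show "recolor c (d1, d2, d3) e = 0" if "e \<notin> E"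
  proof -
    have "e \<notin> {{a1,a2}, {b1,b2}, {a2,a3}, {b2,b3}, {a3,a4}, {b3,b4}, {a1,b1}, {a2,b2}, {a3,b3}, {a4,b4}}"
      using that strip_edges by blast
    then show ?thesis using properD(2)[OF c that] by (simp add: recolor_def)
  qed
  fix v
  show "inj_on (recolor c (d1, d2, d3)) {e \<in> E. v \<in> e}"
  proof (cases "v \<in> {a1, a2, a3, a4, b1, b2, b3, b4}")
    case False
    then have "recolor c (d1, d2, d3) e = c e" if "e \<in> {e \<in> E. v \<in> e}" for e
      using that by (intro recolor_outside[of v]) auto
    moreover have "inj_on c {e \<in> E. v \<in> e}" using properD(3)[OF c] unfolding inj_on_def by blast
    ultimately show ?thesis by (simp add: inj_on_def)
  next
    case True
    have "inj_on (recolor c (d1, d2, d3)) {e \<in> E. w \<in> e}" if "{e \<in> E. w \<in> e} = {e1, e2, e3}"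
      "recolor c (d1, d2, d3) e1 \<noteq> recolor c (d1, d2, d3) e2" "recolor c (d1, d2, d3) e1 \<noteq> recolor c (d1, d2, d3) e3"
      "recolor c (d1, d2, d3) e2 \<noteq> recolor c (d1, d2, d3) e3" for w e1 e2 e3
      unfolding that(1) by (rule inj_on_three) (fact that)+
    note i = this
    note all = inc_a(1)[THEN i] inc_a(2)[THEN i] inc_a(3)[THEN i] inc_a(4)[THEN i]
      inc_b(1)[THEN i] inc_b(2)[THEN i] inc_b(3)[THEN i] inc_b(4)[THEN i]
    note all' = all[unfolded recolor_vals eq]
    have all'': "inj_on (recolor c (d1, d2, d3)) {e \<in> E. a1 \<in> e}" "inj_on (recolor c (d1, d2, d3)) {e \<in> E. a2 \<in> e}"
      "inj_on (recolor c (d1, d2, d3)) {e \<in> E. a3 \<in> e}" "inj_on (recolor c (d1, d2, d3)) {e \<in> E. a4 \<in> e}"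
      "inj_on (recolor c (d1, d2, d3)) {e \<in> E. b1 \<in> e}" "inj_on (recolor c (d1, d2, d3)) {e \<in> E. b2 \<in> e}"
      "inj_on (recolor c (d1, d2, d3)) {e \<in> E. b3 \<in> e}" "inj_on (recolor c (d1, d2, d3)) {e \<in> E. b4 \<in> e}"
      by (rule all'; rule d(6-9) t(2,3,5,6,8,9,11,12) d(6-9)[symmetric] t(2,3,5,6,8,9,11,12)[symmetric])+
    from True show ?thesis by (elim insertE emptyE; simp only: all'')
  qed
qed

text \<open>At both ends of a rung the three colors sum to 6, so agreement of the rails in the
  middle propagates to both ends of the strip; the coloring is then recovered from its walk.\<close>

lemma recolor_id:
  assumes c: "proper_3_edge_coloring E c" and eq: "c {b2,b3} = c {a2,a3}"
  shows "recolor c (c {a1,a2}, c {a2,a3}, c {a3,a4}) = c"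
    "walk (c {a0,a1}) (c {a1,a2}) (c {a2,a3}) (c {a3,a4}) (c {a4,a5})"
    "c {b0,b1} = c {a0,a1}" "c {b4,b5} = c {a4,a5}"
proof -
  note s = sums[OF c]
  have r: "c {b1,b2} = c {a1,a2}" "c {b3,b4} = c {a3,a4}" "6 - c {a0,a1} - c {a1,a2} = c {a1,b1}" 
     "6 - c {a1,a2} - c {a2,a3} = c {a2,b2}" "6 - c {a2,a3} - c {a3,a4} = c {a3,b3}" "6 - c {a3,a4} - c {a4,a5} = c {a4,b4}"
    using s eq by linarith+
  show "c {b0,b1} = c {a0,a1}" "c {b4,b5} = c {a4,a5}" using s eq by linarith+
  show "recolor c (c {a1,a2}, c {a2,a3}, c {a3,a4}) = c"
    unfolding recolor_def prod.case r by (simp add: fun_upd_idem r(1,2) eq)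
  have "c e \<noteq> c f" if "e \<in> E" "f \<in> E" "e \<noteq> f" "e \<inter> f \<noteq> {}" for e f using properD(3)[OF c] that by blast
  then show "walk (c {a0,a1}) (c {a1,a2}) (c {a2,a3}) (c {a3,a4}) (c {a4,a5})"
    unfolding walk_def using strip_edges properD(1)[OF c] by (simp add: doubleton_eq_iff nes del: One_nat_def)
qed

lemma recolor_share:
  assumes c: "proper_3_edge_coloring E c" and eq: "c {b0,b1} = c {a0,a1}" "c {b4,b5} = c {a4,a5}"
    and "walks_share (c {a0,a1}) (c {a4,a5}) t t'"
  shows "(recolor c t, recolor c t') \<in> share_class E"
proof -
  obtain d1 d2 d3 d1' d2' d3' where t: "t = (d1, d2, d3)" "t' = (d1', d2', d3')" by (metis prod_cases3)
  from assms(4) have w: "walk (c {a0,a1}) d1 d2 d3 (c {a4,a5})" "walk (c {a0,a1}) d1' d2' d3' (c {a4,a5})"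
    unfolding t walks_share_def by auto
  obtain y where y: "y \<in> {1, 2, 3}" "(d1 = y \<longleftrightarrow> d1' = y)" "(d2 = y \<longleftrightarrow> d2' = y)" "(d3 = y \<longleftrightarrow> d3' = y)"
      "(6 - c {a0,a1} - d1 = y \<longleftrightarrow> 6 - c {a0,a1} - d1' = y)" "(6 - d1 - d2 = y \<longleftrightarrow> 6 - d1' - d2' = y)" 
      "(6 - d2 - d3 = y \<longleftrightarrow> 6 - d2' - d3' = y)" "(6 - d3 - c {a4,a5} = y \<longleftrightarrow> 6 - d3' - c {a4,a5} = y)"
    using assms(4) unfolding t walks_share_def prod.case by blast
  have "recolor c t e = y \<longleftrightarrow> recolor c t' e = y" for e
    unfolding t recolor_def using y(2-) by simp
  then show ?thesis
    unfolding share_class_def using proper_recolor[OF c w(1) eq] proper_recolor[OF c w(2) eq] y(1) t by blast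
qed

text \<open>The coloring reached hands the rail colors unchanged through the last two rungs, which
  is what makes these rungs removable.\<close>

lemma to_backtrack:
  assumes c: "proper_3_edge_coloring E c" and eq: "c {b2,b3} = c {a2,a3}"
  obtains d where "proper_3_edge_coloring E d" "(c, d) \<in> (share_class E)\<^sup>*"
    "d {a2,a3} = d {a4,a5}" "d {b2,b3} = d {b4,b5}"
proof -
  note i = recolor_id[OF c eq]
  obtain d1 d2 d3 where d: "(walks_share (c {a0,a1}) (c {a4,a5}))\<^sup>*\<^sup>* (c {a1,a2}, c {a2,a3}, c {a3,a4}) (d1, d2, d3)"
      "walk (c {a0,a1}) d1 d2 d3 (c {a4,a5})" "d2 = c {a4,a5}"
    using walk_to_backtrack[OF i(2)] by blast
  have "(recolor c t, recolor c t') \<in> (share_class E)\<^sup>*" if "(walks_share (c {a0,a1}) (c {a4,a5}))\<^sup>*\<^sup>* t t'" for t t'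
    using that by (induction rule: rtranclp_induct) (auto intro: rtrancl_into_rtrancl recolor_share[OF c i(3,4)])
  from this[OF d(1)] have "(c, recolor c (d1, d2, d3)) \<in> (share_class E)\<^sup>*" using i(1) by simp
  then show ?thesis
    by (intro that[of "recolor c (d1, d2, d3)"]) (use proper_recolor[OF c d(2) i(3,4)] d(3) i(4) in \<open>simp_all add: recolor_vals\<close>)
qed

end

section \<open>Lengthening a ladder by two rungs\<close>

locale ladder =
  fixes V :: "'v set" and E :: "'v set set" and a0 a1 a2 r b0 b1 b2 s :: 'v
  assumes graph: "simple_graph V E"
    and lad_distinct: "distinct [a1, a2, b1, b2]"
    and lad_outer: "{a0, r, b0, s} \<inter> {a1, a2, b1, b2} = {}"
    and lad_inc: "{e \<in> E. a1 \<in> e} = {{a0,a1}, {a1,b1}, {a1,a2}}" "{e \<in> E. a2 \<in> e} = {{a1,a2}, {a2,b2}, {a2,r}}"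
      "{e \<in> E. b1 \<in> e} = {{b0,b1}, {a1,b1}, {b1,b2}}" "{e \<in> E. b2 \<in> e} = {{b1,b2}, {a2,b2}, {b2,s}}"

text \<open>The second insertion subdivides the halves \<open>{x1, r}\<close> and
  \<open>{y1, s}\<close> left by the first, so the two new rungs follow the old ones in the same
  ladder.\<close>

definition add_rungs :: "'v \<Rightarrow> 'v \<Rightarrow> 'v \<Rightarrow> 'v \<Rightarrow> 'v \<Rightarrow> 'v \<Rightarrow> 'v \<Rightarrow> 'v \<Rightarrow> 'v set set \<Rightarrow> 'v set set" where
  "add_rungs a r b s x1 y1 x2 y2 E = h_insert x1 r y1 s x2 y2 (h_insert a r b s x1 y1 E)"

locale longer_ladder = ladder +
  fixes x1 y1 x2 y2 :: 'v
  assumes new: "distinct [x1, y1, x2, y2]" and newV: "{x1, y1, x2, y2} \<inter> V = {}"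
begin

abbreviation "E' \<equiv> add_rungs a2 r b2 s x1 y1 x2 y2 E"

lemma edge_sub: "e \<in> E \<Longrightarrow> e \<subseteq> V" and edge_card: "e \<in> E \<Longrightarrow> card e = 2"
  using graph unfolding simple_graph_def by auto

lemma lad_edges: "{a0,a1} \<in> E" "{a1,b1} \<in> E" "{a1,a2} \<in> E" "{a2,b2} \<in> E" "{a2,r} \<in> E"
  "{b0,b1} \<in> E" "{b1,b2} \<in> E" "{b2,s} \<in> E"
  using lad_inc[THEN equalityD2] by simp_all

lemma lad_V: "a0 \<in> V" "a1 \<in> V" "a2 \<in> V" "r \<in> V" "b0 \<in> V" "b1 \<in> V" "b2 \<in> V" "s \<in> V"
  using lad_edges[THEN edge_sub] by simp_all

lemma ne: "a1 \<noteq> a2" "a1 \<noteq> b1" "a1 \<noteq> b2" "a2 \<noteq> b1" "a2 \<noteq> b2" "b1 \<noteq> b2"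
  "a0 \<noteq> a1" "a0 \<noteq> a2" "a0 \<noteq> b1" "a0 \<noteq> b2" "b0 \<noteq> a1" "b0 \<noteq> a2" "b0 \<noteq> b1" "b0 \<noteq> b2"
  "r \<noteq> a1" "r \<noteq> a2" "r \<noteq> b1" "r \<noteq> b2" "s \<noteq> a1" "s \<noteq> a2" "s \<noteq> b1" "s \<noteq> b2"
  "x1 \<noteq> y1" "x1 \<noteq> x2" "x1 \<noteq> y2" "y1 \<noteq> x2" "y1 \<noteq> y2" "x2 \<noteq> y2"
  using lad_distinct lad_outer new by auto

lemma fresh: "v \<in> V \<Longrightarrow> v \<noteq> x1" "v \<in> V \<Longrightarrow> v \<noteq> y1" "v \<in> V \<Longrightarrow> v \<noteq> x2" "v \<in> V \<Longrightarrow> v \<noteq> y2"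
  using newV by auto

lemmas nes = ne ne[symmetric] lad_V[THEN fresh(1)] lad_V[THEN fresh(2)] lad_V[THEN fresh(3)] lad_V[THEN fresh(4)]
  lad_V[THEN fresh(1), symmetric] lad_V[THEN fresh(2), symmetric] lad_V[THEN fresh(3), symmetric] lad_V[THEN fresh(4), symmetric]

lemma new_notin: "e \<in> E \<Longrightarrow> x1 \<notin> e" "e \<in> E \<Longrightarrow> y1 \<notin> e" "e \<in> E \<Longrightarrow> x2 \<notin> e" "e \<in> E \<Longrightarrow> y2 \<notin> e"
  using edge_sub newV by auto

definition new_edges where "new_edges = {{a2,x1},{x1,x2},{x2,r},{b2,y1},{y1,y2},{y2,s},{x1,y1},{x2,y2}}"

definition old_edges where "old_edges = E - {{a2,r},{b2,s}}"

lemma E'_eq: "E' = new_edges \<union> old_edges"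
proof -
  have "{x1,r} \<notin> E" "{y1,s} \<notin> E" using new_notin by blast+
  then have 2: "old_edges - {{x1,r},{y1,s}} = old_edges" unfolding old_edges_def by blast
  have 1: "{{a2,x1},{x1,r},{b2,y1},{y1,s},{x1,y1}} - {{x1,r},{y1,s}} = {{a2,x1},{b2,y1},{x1,y1}}"
    by (simp add: insert_Diff_if doubleton_eq_iff nes)
  have 3: "h_insert a2 r b2 s x1 y1 E - {{x1,r},{y1,s}} = {{a2,x1},{b2,y1},{x1,y1}} \<union> old_edges"
    unfolding h_insert_def Un_Diff old_edges_def[symmetric] 1 2 ..
  have 4: "{p1, p2, p3, p4, p5} \<union> ({q1, q2, q3} \<union> Q) = {q1, p1, p2, q2, p3, p4, q3, p5} \<union> Q" for p1 p2 p3 p4 p5 q1 q2 q3 and Q :: "'v set set"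
    by blast
  show ?thesis unfolding add_rungs_def h_insert_def[of x1 r y1 s x2 y2] 3 new_edges_def by (rule 4)
qed

lemma old_not_new: "e \<in> E \<Longrightarrow> e \<notin> new_edges"
  unfolding new_edges_def using new_notin[of e] by auto

lemma E'_cases:
  assumes "e \<in> E'"
  obtains "e \<in> old_edges" | "e \<in> new_edges"
  using assms unfolding E'_eq by blast

lemma new_in: "{a2,x1} \<in> E'" "{x1,x2} \<in> E'" "{x2,r} \<in> E'" "{b2,y1} \<in> E'" "{y1,y2} \<in> E'" "{y2,s} \<in> E'" "{x1,y1} \<in> E'" "{x2,y2} \<in> E'"
  unfolding E'_eq new_edges_def by simp_all

lemma old_in: "e \<in> old_edges \<Longrightarrow> e \<in> E'" "e \<in> old_edges \<Longrightarrow> e \<in> E"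
  unfolding E'_eq old_edges_def by simp_all

lemma inc_split: "{e \<in> E'. v \<in> e} = {e \<in> new_edges. v \<in> e} \<union> ({e \<in> E. v \<in> e} - {{a2,r},{b2,s}})"
  unfolding E'_eq old_edges_def by blast

lemma inc_new: "{e \<in> E'. x1 \<in> e} = {{a2,x1}, {x1,y1}, {x1,x2}}" "{e \<in> E'. x2 \<in> e} = {{x1,x2}, {x2,y2}, {x2,r}}"
  "{e \<in> E'. y1 \<in> e} = {{b2,y1}, {x1,y1}, {y1,y2}}" "{e \<in> E'. y2 \<in> e} = {{y1,y2}, {x2,y2}, {y2,s}}"
proof -
  have em: "{e \<in> E. x1 \<in> e} = {}" "{e \<in> E. x2 \<in> e} = {}" "{e \<in> E. y1 \<in> e} = {}" "{e \<in> E. y2 \<in> e} = {}"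
    using new_notin by blast+
  show "{e \<in> E'. x1 \<in> e} = {{a2,x1}, {x1,y1}, {x1,x2}}" "{e \<in> E'. x2 \<in> e} = {{x1,x2}, {x2,y2}, {x2,r}}"
    "{e \<in> E'. y1 \<in> e} = {{b2,y1}, {x1,y1}, {y1,y2}}" "{e \<in> E'. y2 \<in> e} = {{y1,y2}, {x2,y2}, {y2,s}}"
    unfolding inc_split new_edges_def Collect_insert_conj em by (simp_all add: nes insert_commute)
qed

lemma inc_old: "{e \<in> E'. a1 \<in> e} = {{a0,a1}, {a1,b1}, {a1,a2}}" "{e \<in> E'. a2 \<in> e} = {{a1,a2}, {a2,b2}, {a2,x1}}"
  "{e \<in> E'. b1 \<in> e} = {{b0,b1}, {a1,b1}, {b1,b2}}" "{e \<in> E'. b2 \<in> e} = {{b1,b2}, {a2,b2}, {b2,y1}}"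
  unfolding inc_split new_edges_def lad_inc Collect_insert_conj
  by (simp_all add: nes doubleton_eq_iff insert_Diff_if insert_commute)

sublocale strip E' a0 a1 a2 x1 x2 r b0 b1 b2 y1 y2 s
  by unfold_locales (simp_all only: inc_new inc_old, simp_all add: nes)

text \<open>The color \<open>k\<close> of the two new rungs is free if \<open>{a2,r}\<close> and \<open>{b2,s}\<close> have equal colors, and forced otherwise.\<close>
definition lift :: "nat \<Rightarrow> ('v set \<Rightarrow> nat) \<Rightarrow> 'v set \<Rightarrow> nat" where
  "lift k c = c({a2,r} := 0, {b2,s} := 0, {a2,x1} := c {a2,r}, {x2,r} := c {a2,r}, {b2,y1} := c {b2,s}, {y2,s} := c {b2,s},
     {x1,y1} := k, {x2,y2} := k, {x1,x2} := 6 - k - c {a2,r}, {y1,y2} := 6 - k - c {b2,s})"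

lemma lift_vals: "lift k c {a2,x1} = c {a2,r}" "lift k c {x2,r} = c {a2,r}" "lift k c {b2,y1} = c {b2,s}" "lift k c {y2,s} = c {b2,s}"
  "lift k c {x1,y1} = k" "lift k c {x2,y2} = k" "lift k c {x1,x2} = 6 - k - c {a2,r}" "lift k c {y1,y2} = 6 - k - c {b2,s}"
  "lift k c {a2,r} = 0" "lift k c {b2,s} = 0"
  by (simp_all add: lift_def doubleton_eq_iff nes)

lemma lift_other:
  assumes "e \<notin> {{a2,r},{b2,s}}" "e \<notin> new_edges"
  shows "lift k c e = c e"
  using assms unfolding new_edges_def lift_def by simp

lemma lift_old:
  assumes "e \<in> old_edges"
  shows "lift k c e = c e"
  using assms old_not_new by (intro lift_other) (auto simp: old_edges_def)

lemma e1_ne_f1: "{a2,r} \<noteq> {b2,s}" by (simp add: doubleton_eq_iff nes)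

abbreviation "ok k c \<equiv> k \<in> {1, 2, 3} \<and> k \<noteq> c {a2,r} \<and> k \<noteq> c {b2,s}"

text \<open>Sends the outer pieces of the two subdivided edges back to those edges; with colors from
  \<open>lift\<close> this preserves colors.\<close>

definition merge where
  "merge e = (if e = {a2,x1} \<or> e = {x2,r} then {a2,r} else if e = {b2,y1} \<or> e = {y2,s} then {b2,s} else e)"

text \<open>Inverse to \<open>merge\<close> among the edges at an old vertex \<open>v\<close>: the
  vertex decides which piece of the subdivided edge is meant. Properness at \<open>v\<close> is
  thereby transported in both directions.\<close>

definition unmerge where
  "unmerge v e = (if e = {a2,r} then (if v = a2 then {a2,x1} else {x2,r}) else
     if e = {b2,s} then (if v = b2 then {b2,y1} else {y2,s}) else e)"

lemma merge_vals: "merge {a2,x1} = {a2,r}" "merge {x2,r} = {a2,r}" "merge {b2,y1} = {b2,s}" "merge {y2,s} = {b2,s}"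
  by (simp_all add: merge_def doubleton_eq_iff nes)

lemma unmerge_vals: "unmerge a2 {a2,r} = {a2,x1}" "unmerge r {a2,r} = {x2,r}" "unmerge b2 {b2,s} = {b2,y1}" "unmerge s {b2,s} = {y2,s}"
  by (simp_all add: unmerge_def doubleton_eq_iff nes)

lemma merge_old: "e \<in> old_edges \<Longrightarrow> merge e = e"
  using old_not_new[OF old_in(2)] unfolding merge_def new_edges_def by auto

lemma unmerge_old: "e \<in> old_edges \<Longrightarrow> unmerge v e = e"
  unfolding unmerge_def old_edges_def by simp

lemma proper_lift:
  assumes c: "proper_3_edge_coloring E c" and k: "ok k c"
  shows "proper_3_edge_coloring E' (lift k c)"
proof (rule properI_incident)
  have p: "c {a2,r} \<in> {1, 2, 3}" "c {b2,s} \<in> {1, 2, 3}" by (rule properD(1)[OF c], rule lad_edges)+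
  have k': "k \<in> {1, 2, 3}" "k \<noteq> c {a2,r}" "k \<noteq> c {b2,s}" using k by simp_all
  note t = third_color[OF k'(1) p(1) k'(2)] third_color[OF k'(1) p(2) k'(3)]
  fix e
  show "lift k c e \<in> {1, 2, 3}" if "e \<in> E'"
    using that
  proof (cases rule: E'_cases)
    case 1
    then show ?thesis unfolding lift_old[OF 1] by (intro properD(1)[OF c] old_in)
  next
    case 2
    then show ?thesis unfolding new_edges_def by (elim insertE emptyE; simp only: lift_vals p k' t)
  qed
  show "lift k c e = 0" if "e \<notin> E'"
  proof (cases "e \<in> {{a2,r},{b2,s}}")
    case True
    then show ?thesis by (elim insertE emptyE; simp only: lift_vals)
  next
    case False
    then have "e \<notin> E" "e \<notin> new_edges" using that unfolding E'_eq old_edges_def by auto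
    then show ?thesis using lift_other[OF False] properD(2)[OF c] by simp
  qed
  fix v
  show "inj_on (lift k c) {e \<in> E'. v \<in> e}"
  proof (cases "v \<in> {x1, x2, y1, y2}")
    case True
    have "inj_on (lift k c) {e \<in> E'. w \<in> e}" if "{e \<in> E'. w \<in> e} = {e1, e2, e3}"
      "lift k c e1 \<noteq> lift k c e2" "lift k c e1 \<noteq> lift k c e3" "lift k c e2 \<noteq> lift k c e3" for w e1 e2 e3
      unfolding that(1) by (rule inj_on_three) (fact that)+
    note i = this
    note all = inc_new(1)[THEN i] inc_new(2)[THEN i] inc_new(3)[THEN i] inc_new(4)[THEN i]
    note all' = all[unfolded lift_vals]
    have all'': "inj_on (lift k c) {e \<in> E'. x1 \<in> e}" "inj_on (lift k c) {e \<in> E'. x2 \<in> e}" "inj_on (lift k c) {e \<in> E'. y1 \<in> e}" "inj_on (lift k c) {e \<in> E'. y2 \<in> e}"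
      by (rule all'; rule k'(2,3) t(2,3,5,6) k'(2,3)[symmetric] t(2,3,5,6)[symmetric])+
    from True show ?thesis by (elim insertE emptyE; simp only: all'')
  next
    case False
    have cases: "e \<in> old_edges \<or> e = {a2,x1} \<and> v = a2 \<or> e = {x2,r} \<and> v = r \<or>
        e = {b2,y1} \<and> v = b2 \<or> e = {y2,s} \<and> v = s" if "e \<in> E'" "v \<in> e" for e
      using that(1)
    proof (cases rule: E'_cases)
      case 2
      then show ?thesis using that(2) False unfolding new_edges_def by (elim insertE emptyE; simp)
    qed blast
    have m: "merge e \<in> E \<and> v \<in> merge e \<and> lift k c e = c (merge e) \<and> unmerge v (merge e) = e" if "e \<in> E'" "v \<in> e" for e
      using cases[OF that] by (elim disjE conjE) (simp_all add: merge_vals unmerge_vals lad_edges lift_vals lift_old old_in that merge_old unmerge_old)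
    show ?thesis
    proof (rule inj_onI, rule ccontr)
      fix e f assume ef: "e \<in> {e \<in> E'. v \<in> e}" "f \<in> {e \<in> E'. v \<in> e}" "lift k c e = lift k c f" "e \<noteq> f"
      then have e: "merge e \<in> E \<and> v \<in> merge e \<and> lift k c e = c (merge e) \<and> unmerge v (merge e) = e" 
        and f: "merge f \<in> E \<and> v \<in> merge f \<and> lift k c f = c (merge f) \<and> unmerge v (merge f) = f" using m by blast+
      then have "merge e \<noteq> merge f" "merge e \<inter> merge f \<noteq> {}" using ef(4) by (metis, blast)
      then show False using properD(3)[OF c, of "merge e" "merge f"] e f ef(3) by simp
    qed
  qed
qed

text \<open>Once both rails leave the new rungs with the color they brought, the sums at the four
  new vertices force everything there from the color of \<open>{x1, y1}\<close>.\<close>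

lemma project:
  assumes c: "proper_3_edge_coloring E' c" and eq: "c {a2,x1} = c {x2,r}" "c {b2,y1} = c {y2,s}"
  obtains d k where "proper_3_edge_coloring E d" "ok k d" "c = lift k d"
proof -
  define d where "d = (\<lambda>e. if e = {a2,r} then c {a2,x1} else if e = {b2,s} then c {b2,y1} else if e \<in> E then c e else 0)"
  have dv: "d {a2,r} = c {a2,x1}" "d {b2,s} = c {b2,y1}" using e1_ne_f1 by (simp_all add: d_def)
  have E': "{a2,x1} \<in> E'" "{b2,y1} \<in> E'" "{x2,r} \<in> E'" "{y2,s} \<in> E'" "{x1,y1} \<in> E'" by (rule new_in)+
  have d_old: "d e = c e" if "e \<in> old_edges" for e using that by (simp add: d_def old_edges_def)
  have E_cases: "e = {a2,r} \<or> e = {b2,s} \<or> e \<in> old_edges" if "e \<in> E" for e using that unfolding old_edges_def by blast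
  have proper: "proper_3_edge_coloring E d"
  proof (rule properI_incident)
    fix e
    show "d e \<in> {1, 2, 3}" if "e \<in> E"
      using E_cases[OF that] by (elim disjE) (simp_all only: dv d_old properD(1)[OF c] E' old_in)
    show "d e = 0" if "e \<notin> E" using that lad_edges by (auto simp: d_def)
    fix v
    have cases: "e \<in> old_edges \<or> e = {a2,r} \<and> (v = a2 \<or> v = r) \<or> e = {b2,s} \<and> (v = b2 \<or> v = s)" if "e \<in> E" "v \<in> e" for e
      using E_cases[OF that(1)] that(2) by auto
    have m: "unmerge v e \<in> E' \<and> v \<in> unmerge v e \<and> d e = c (unmerge v e) \<and> merge (unmerge v e) = e" if "e \<in> E" "v \<in> e" for e
      using cases[OF that] by (elim disjE conjE) (simp_all add: E' eq dv d_old old_in that merge_vals unmerge_vals merge_old unmerge_old)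
    show "inj_on d {e \<in> E. v \<in> e}"
    proof (rule inj_onI, rule ccontr)
      fix e f assume ef: "e \<in> {e \<in> E. v \<in> e}" "f \<in> {e \<in> E. v \<in> e}" "d e = d f" "e \<noteq> f"
      then have e: "unmerge v e \<in> E' \<and> v \<in> unmerge v e \<and> d e = c (unmerge v e) \<and> merge (unmerge v e) = e" 
        and f: "unmerge v f \<in> E' \<and> v \<in> unmerge v f \<and> d f = c (unmerge v f) \<and> merge (unmerge v f) = f" using m by blast+
      then have "unmerge v e \<noteq> unmerge v f" "unmerge v e \<inter> unmerge v f \<noteq> {}" using ef(4) by (metis, blast)
      then show False using properD(3)[OF c, of "unmerge v e" "unmerge v f"] e f ef(3) by simp
    qed
  qed
  have ne': "c {x1,y1} \<noteq> c {a2,x1}" "c {x1,y1} \<noteq> c {b2,y1}"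
    by (rule properD(3)[OF c]; simp add: new_in doubleton_eq_iff nes)+
  have ok: "ok (c {x1,y1}) d" using ne' properD(1)[OF c E'(5)] unfolding dv by (intro conjI)
  have s: "c {x2,y2} = c {x1,y1}" "c {x1,x2} = 6 - c {x1,y1} - c {a2,x1}" "c {y1,y2} = 6 - c {x1,y1} - c {b2,y1}"
    using sums(3,4,7,8)[OF c] eq by linarith+
  have "c e = lift (c {x1,y1}) d e" for e
  proof -
    show ?thesis
    proof (cases "e \<in> E'")
      case True
      then show ?thesis
      proof (cases rule: E'_cases)
        case 1 then show ?thesis by (simp only: lift_old d_old)
      next
        case 2 then show ?thesis unfolding new_edges_def by (elim insertE emptyE; simp only: lift_vals dv s eq)
      qed
    next
      case False
      then show ?thesis using properD(2)[OF proper_lift[OF proper ok]] properD(2)[OF c] by simp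
    qed
  qed
  then have "c = lift (c {x1,y1}) d" by (rule ext)
  then show ?thesis using that[OF proper ok] by blast
qed

lemma lift_share:
  assumes c: "proper_3_edge_coloring E c" and d: "proper_3_edge_coloring E d" and k: "ok k c" and l: "ok l d"
    and y: "y \<in> {1, 2, 3}" "\<forall>e\<in>E. c e = y \<longleftrightarrow> d e = y"
    and kl: "k = y \<longleftrightarrow> l = y" "6 - k - c {a2,r} = y \<longleftrightarrow> 6 - l - d {a2,r} = y" "6 - k - c {b2,s} = y \<longleftrightarrow> 6 - l - d {b2,s} = y"
  shows "(lift k c, lift l d) \<in> share_class E'"
proof -
  have y': "c {a2,r} = y \<longleftrightarrow> d {a2,r} = y" "c {b2,s} = y \<longleftrightarrow> d {b2,s} = y" using y(2) lad_edges by simp_all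
  have "lift k c e = y \<longleftrightarrow> lift l d e = y" if "e \<in> E'" for e
    using that
  proof (cases rule: E'_cases)
    case 1 then show ?thesis using y(2) by (simp only: lift_old old_in)
  next
    case 2 then show ?thesis unfolding new_edges_def by (elim insertE emptyE; simp only: lift_vals y' kl)
  qed
  then show ?thesis unfolding share_class_def
    using proper_lift[OF c k] proper_lift[OF d l] y(1) by (intro CollectI case_prodI conjI bexI[of _ y]) simp_all
qed

text \<open>Two different choices \<open>k\<close> and \<open>l\<close> are possible only if both
  rails have the third color. The lifts then differ by switching the 4-cycle of the new vertices and
  share the class of the rail color.\<close>

lemma lift_two:
  assumes c: "proper_3_edge_coloring E c" and k: "ok k c" and l: "ok l c"
  shows "(lift k c, lift l c) \<in> (share_class E')\<^sup>*"
proof (cases "k = l")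
  case False
  have p: "c {a2,r} \<in> {1, 2, 3}" "c {b2,s} \<in> {1, 2, 3}" by (rule properD(1)[OF c], rule lad_edges)+
  have k': "k \<in> {1, 2, 3}" "k \<noteq> c {a2,r}" "k \<noteq> c {b2,s}" "l \<in> {1, 2, 3}" "l \<noteq> c {a2,r}" "l \<noteq> c {b2,s}" using k l by simp_all
  have "k + l + c {a2,r} = 6" "k + l + c {b2,s} = 6" by (rule sum_three_colors; (rule k' p False))+
  then have "c {a2,r} = c {b2,s}" by linarith
  then have "(lift k c, lift l c) \<in> share_class E'"
    using k' third_color[OF k'(1) p(1) k'(2)] third_color[OF k'(4) p(1) k'(5)]
    by (intro lift_share[OF c c k l p(1)]) simp_all
  then show ?thesis by blast
qed simp

text \<open>Lets a step between colorings of the short ladder be lifted. If no rail has color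
  \<open>y\<close>, the rungs get \<open>y\<close>. If exactly one has it, the rung color is forced.
  If both have it, any common color other than \<open>y\<close> serves.\<close>

lemma lift_choice:
  fixes p q p' q' y :: nat
  assumes "p \<in> {1, 2, 3}" "q \<in> {1, 2, 3}" "p' \<in> {1, 2, 3}" "q' \<in> {1, 2, 3}" "y \<in> {1, 2, 3}" "p = y \<longleftrightarrow> p' = y" "q = y \<longleftrightarrow> q' = y"
  obtains k l where "k \<in> {1, 2, 3}" "l \<in> {1, 2, 3}" "k \<noteq> p" "k \<noteq> q" "l \<noteq> p'" "l \<noteq> q'" "k = y \<longleftrightarrow> l = y"
    "6 - k - p = y \<longleftrightarrow> 6 - l - p' = y" "6 - k - q = y \<longleftrightarrow> 6 - l - q' = y"
proof -
  have t: "\<exists>k\<in>{1, 2, 3}. k \<noteq> y \<and> k \<noteq> z \<and> 6 - k - y = z \<and> 6 - k - z = y" if "z \<in> {1, 2, 3}" "z \<noteq> y" for z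
    using assms(5) that by (elim insertE emptyE; simp)
  have t': "6 - y - z \<noteq> y" if "z \<in> {1, 2, 3}" "z \<noteq> y" for z
    using third_color(2)[OF assms(5) that(1)] that(2) by blast
  consider "p \<noteq> y" "q \<noteq> y" "p' \<noteq> y" "q' \<noteq> y" | "p = y" "q \<noteq> y" "p' = y" "q' \<noteq> y"
    | "p \<noteq> y" "q = y" "p' \<noteq> y" "q' = y" | "p = y" "q = y" "p' = y" "q' = y" using assms(6,7) by blast
  then show ?thesis
  proof cases
    case 1
    show ?thesis
      by (rule that[of y y]) (use 1 in \<open>simp_all only: assms t' not_sym simp_thms\<close>)
  next
    case 2
    obtain k l where "k \<in> {1, 2, 3}" "k \<noteq> y" "k \<noteq> q" "6 - k - y = q" "6 - k - q = y"
      "l \<in> {1, 2, 3}" "l \<noteq> y" "l \<noteq> q'" "6 - l - y = q'" "6 - l - q' = y"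
      using t[OF assms(2) 2(2)] t[OF assms(4) 2(4)] by (elim bexE conjE)
    then show ?thesis by (intro that[of k l]) (simp_all only: 2 simp_thms)
  next
    case 3
    obtain k l where "k \<in> {1, 2, 3}" "k \<noteq> y" "k \<noteq> p" "6 - k - y = p" "6 - k - p = y"
      "l \<in> {1, 2, 3}" "l \<noteq> y" "l \<noteq> p'" "6 - l - y = p'" "6 - l - p' = y"
      using t[OF assms(1) 3(1)] t[OF assms(3) 3(3)] by (elim bexE conjE)
    then show ?thesis by (intro that[of k l]) (simp_all only: 3 simp_thms)
  next
    case 4
    have "\<exists>k\<in>{1, 2, 3}. k \<noteq> y" using assms(5) by (elim insertE emptyE) simp_all
    then obtain k where "k \<in> {1, 2, 3}" "k \<noteq> y" by (elim bexE)
    then show ?thesis by (intro that[of k k]) (simp_all only: 4 simp_thms)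
  qed
qed

text \<open>The rung color suitable for one step need not suit the next; \<open>lift_two\<close>
  adjusts it in between, hence the induction is over all \<open>l\<close>.\<close>

lemma lift_star:
  assumes "(c, d) \<in> (share_class E)\<^sup>*" "proper_3_edge_coloring E c" "ok k c" "ok l d"
  shows "(lift k c, lift l d) \<in> (share_class E')\<^sup>*"
  using assms
proof (induction arbitrary: l rule: rtrancl_induct)
  case base
  show ?case by (rule lift_two[OF base(1-3)])
next
  case (step d e)
  obtain y where y: "y \<in> {1, 2, 3}" "\<forall>x\<in>E. d x = y \<longleftrightarrow> e x = y" and d: "proper_3_edge_coloring E d" and e: "proper_3_edge_coloring E e"
    using step.hyps(2) unfolding share_class_def by auto
  have v: "d {a2,r} \<in> {1, 2, 3}" "d {b2,s} \<in> {1, 2, 3}" "e {a2,r} \<in> {1, 2, 3}" "e {b2,s} \<in> {1, 2, 3}"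
    by (rule properD(1)[OF d] properD(1)[OF e], rule lad_edges)+
  have "d {a2,r} = y \<longleftrightarrow> e {a2,r} = y" "d {b2,s} = y \<longleftrightarrow> e {b2,s} = y" using y(2) lad_edges by simp_all
  then obtain m n where mn0: "m \<in> {1, 2, 3}" "n \<in> {1, 2, 3}" "m \<noteq> d {a2,r}" "m \<noteq> d {b2,s}" "n \<noteq> e {a2,r}" "n \<noteq> e {b2,s}" and mn: "m = y \<longleftrightarrow> n = y"
    "6 - m - d {a2,r} = y \<longleftrightarrow> 6 - n - e {a2,r} = y" "6 - m - d {b2,s} = y \<longleftrightarrow> 6 - n - e {b2,s} = y"
    by (rule lift_choice[OF v y(1)])
  have m: "ok m d" and n: "ok n e" using mn0 by simp_all
  have "(lift m d, lift n e) \<in> share_class E'" by (rule lift_share[OF d e m n y mn])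
  moreover have "(lift n e, lift l e) \<in> (share_class E')\<^sup>*" by (rule lift_two[OF e n step.prems(3)])
  ultimately show ?case using step.IH[OF step.prems(1,2) m] by (meson rtrancl_into_rtrancl rtrancl_trans)
qed

lemma to_lift:
  assumes c: "proper_3_edge_coloring E' c"
  obtains d k where "proper_3_edge_coloring E d" "ok k d" "(c, lift k d) \<in> (share_class E')\<^sup>*"
proof (cases "c {b2,y1} = c {a2,x1}")
  case True
  obtain e where e: "proper_3_edge_coloring E' e" "(c, e) \<in> (share_class E')\<^sup>*" "e {a2,x1} = e {x2,r}" "e {b2,y1} = e {y2,s}"
    using to_backtrack[OF c True] by blast
  obtain d k where "proper_3_edge_coloring E d" "ok k d" "e = lift k d" by (rule project[OF e(1,3,4)])
  then show ?thesis using that e(2) by simp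
next
  case False
  note s = sums[OF c]
  have v: "c e \<in> {1, 2, 3}" if "e \<in> E'" for e using properD(1)[OF c that] .
  have k: "c {x1,y1} \<noteq> c {a2,x1}" "c {x1,y1} \<noteq> c {b2,y1}" "c {x2,y2} \<noteq> c {x1,x2}" "c {x2,y2} \<noteq> c {y1,y2}"
    by (rule properD(3)[OF c]; simp add: new_in doubleton_eq_iff nes)+
  have 1: "c {a2,x1} + c {b2,y1} + c {x1,y1} = 6"
    by (rule sum_three_colors[OF v v v]; (rule new_in False[symmetric] k[symmetric])?)
  \<comment> \<open>With different rail colors a rung must carry the third color, so passing it
    exchanges the rail colors; the second new rung exchanges them back.\<close>
  have 2: "c {x1,x2} = c {b2,y1}" "c {y1,y2} = c {a2,x1}" using s(3,7) 1 by linarith+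
  have "c {x1,x2} \<noteq> c {y1,y2}" using False unfolding 2 by simp
  then have "c {x1,x2} + c {y1,y2} + c {x2,y2} = 6"
    by (intro sum_three_colors[OF v v v] new_in k[symmetric])
  then have "c {a2,x1} = c {x2,r}" "c {b2,y1} = c {y2,s}" using s 1 2 by linarith+
  then obtain d k where "proper_3_edge_coloring E d" "ok k d" "c = lift k d" by (rule project[OF c])
  then show ?thesis using that by simp
qed

lemma linked_longer: assumes "linked E" shows "linked E'"
  unfolding linked_def
proof (intro conjI allI impI)
  obtain c where c: "proper_3_edge_coloring E c" using assms unfolding linked_def by blast
  have p: "c {a2,r} \<in> {1, 2, 3}" "c {b2,s} \<in> {1, 2, 3}" by (rule properD(1)[OF c], rule lad_edges)+
  \<comment> \<open>The choice lemma is used with \<open>c\<close> in both roles, merely to find an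
    admissible rung color.\<close>
  obtain k l where "k \<in> {1, 2, 3}" "k \<noteq> c {a2,r}" "k \<noteq> c {b2,s}"
    by (rule lift_choice[OF p p, of 1]) simp_all
  then have "ok k c" by simp
  then show "\<exists>c. proper_3_edge_coloring E' c" using proper_lift[OF c] by blast
next
  fix c d assume c: "proper_3_edge_coloring E' c" and d: "proper_3_edge_coloring E' d"
  obtain c0 k where 1: "proper_3_edge_coloring E c0" "ok k c0" "(c, lift k c0) \<in> (share_class E')\<^sup>*"
    by (rule to_lift[OF c])
  obtain d0 l where 2: "proper_3_edge_coloring E d0" "ok l d0" "(d, lift l d0) \<in> (share_class E')\<^sup>*"
    by (rule to_lift[OF d])
  have "(c0, d0) \<in> (share_class E)\<^sup>*" using assms 1 2 unfolding linked_def by blast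
  then have "(lift k c0, lift l d0) \<in> (share_class E')\<^sup>*" by (rule lift_star) (fact 1(1,2) 2(2))+
  moreover have "(lift l d0, d) \<in> (share_class E')\<^sup>*" using 2(3) sym_rtrancl[OF sym_share_class] by (meson symD)
  ultimately show "(c, d) \<in> (share_class E')\<^sup>*" using 1(3) by (meson rtrancl_trans)
qed

end

section \<open>Enumeration of colorings\<close>

definition edge :: "'v \<times> 'v \<Rightarrow> 'v set" where
  "edge = (\<lambda>(a, b). {a, b})"

fun meets :: "'v \<times> 'v \<Rightarrow> 'v \<times> 'v \<Rightarrow> bool" where
  "meets (a, b) (c, d) \<longleftrightarrow> a = c \<or> a = d \<or> b = c \<or> b = d"

fun fits :: "('v \<times> 'v) list \<Rightarrow> nat list \<Rightarrow> 'v \<times> 'v \<Rightarrow> nat \<Rightarrow> bool" where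
  "fits (f # es) (l # ks) e k \<longleftrightarrow> (meets e f \<longrightarrow> k \<noteq> l) \<and> fits es ks e k"
| "fits _ _ e k \<longleftrightarrow> True"

text \<open>
  Colorings are lists of colors parallel to \<open>es @ B\<close>. Since colors may be permuted, the three edges \<open>B\<close> at one
  vertex are fixed to have the colors 1, 2, 3.
\<close>
fun colorings :: "('v \<times> 'v) list \<Rightarrow> ('v \<times> 'v) list \<Rightarrow> nat list list" where
  "colorings B [] = [[1, 2, 3]]"
| "colorings B (e # es) = concat (map (\<lambda>ks. map (\<lambda>k. k # ks) (filter (fits (es @ B) ks e) [1, 2, 3])) (colorings B es))"

fun same_class :: "nat \<Rightarrow> nat list \<Rightarrow> nat list \<Rightarrow> bool" where
  "same_class y (k # ks) (l # ls) \<longleftrightarrow> (k = y \<longleftrightarrow> l = y) \<and> same_class y ks ls"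
| "same_class y _ _ \<longleftrightarrow> True"

text \<open>Breadth-first search with frontier \<open>D\<close>, unvisited colorings as last argument, and at most \<open>n\<close> rounds.\<close>
fun connects :: "nat \<Rightarrow> nat list list \<Rightarrow> nat list list \<Rightarrow> bool" where
  "connects n D [] \<longleftrightarrow> True"
| "connects 0 D (t # T) \<longleftrightarrow> False"
| "connects (Suc n) D (t # T) \<longleftrightarrow>
    (let P = partition (\<lambda>t. \<exists>d\<in>set D. \<exists>y\<in>set [1, 2, 3]. same_class y d t) (t # T) in connects n (fst P) (snd P))"

lemma meets_iff: "meets e f \<longleftrightarrow> edge e \<inter> edge f \<noteq> {}"
  by (cases e; cases f) (auto simp: edge_def)

text \<open>Membership in \<open>colorings\<close> as a recursive predicate, suited to induction
  over the edge list.\<close>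

fun legal :: "('v \<times> 'v) list \<Rightarrow> ('v \<times> 'v) list \<Rightarrow> nat list \<Rightarrow> bool" where
  "legal B [] ks \<longleftrightarrow> ks = [1, 2, 3]"
| "legal B (e # es) [] \<longleftrightarrow> False"
| "legal B (e # es) (k # ks) \<longleftrightarrow> k \<in> {1, 2, 3} \<and> fits (es @ B) ks e k \<and> legal B es ks"

lemma set_colorings: "ks \<in> set (colorings B es) \<longleftrightarrow> legal B es ks"
proof (induction es arbitrary: ks)
  case (Cons e es)
  then show ?case by (cases ks) (auto simp del: One_nat_def)
qed simp

lemma fits_map: "fits es (map g es) e k \<longleftrightarrow> (\<forall>f\<in>set es. meets e f \<longrightarrow> k \<noteq> g f)"
  by (induction es) auto

lemma same_class_map: "same_class y (map g es) (map h es) \<longleftrightarrow> (\<forall>e\<in>set es. g e = y \<longleftrightarrow> h e = y)"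
  by (induction es) auto

lemma legal_length: "legal B es ks \<Longrightarrow> length B = 3 \<Longrightarrow> length ks = length (es @ B)"
  by (induction B es ks rule: legal.induct) auto

lemma legal_mapI:
  assumes "map g B = [1, 2, 3]" "distinct (map edge (es @ B))"
    "\<And>e. e \<in> set (es @ B) \<Longrightarrow> g e \<in> {1, 2, 3}"
    "\<And>e f. e \<in> set (es @ B) \<Longrightarrow> f \<in> set (es @ B) \<Longrightarrow> edge e \<noteq> edge f \<Longrightarrow> meets e f \<Longrightarrow> g e \<noteq> g f"
  shows "legal B es (map g (es @ B))"
  using assms
proof (induction es)
  case (Cons e es)
  have "legal B es (map g (es @ B))"
    by (rule Cons.IH) (use Cons.prems in \<open>auto simp del: One_nat_def\<close>)
  moreover have "\<forall>f\<in>set (es @ B). meets e f \<longrightarrow> g e \<noteq> g f"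
  proof (intro ballI impI)
    fix f assume f: "f \<in> set (es @ B)" "meets e f"
    then have "edge e \<noteq> edge f" using Cons.prems(2) by (metis append_Cons distinct.simps(2) image_eqI list.simps(9) list.set_map)
    then show "g e \<noteq> g f" using Cons.prems(4)[of e f] f by simp
  qed
  then have "fits (es @ B) (map g (es @ B)) e (g e)" unfolding fits_map .
  moreover have "g e \<in> {1, 2, 3}" by (rule Cons.prems(3)) simp
  ultimately show ?case by simp
qed simp

lemma legal_mapD:
  assumes "legal B es (map g (es @ B))" "length B = 3"
  shows "(\<forall>e\<in>set (es @ B). g e \<in> {1, 2, 3}) \<and>
    (\<forall>e\<in>set (es @ B). \<forall>f\<in>set (es @ B). e \<noteq> f \<longrightarrow> meets e f \<longrightarrow> g e \<noteq> g f)"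
  using assms
proof (induction es)
  case Nil
  then obtain a b c where B: "B = [a, b, c]" by (auto simp: length_Suc_conv numeral_3_eq_3)
  with Nil have "g a = 1" "g b = 2" "g c = 3" by auto
  then show ?case using B by auto
next
  case (Cons e es)
  then have l: "legal B es (map g (es @ B))" "fits (es @ B) (map g (es @ B)) e (g e)" "g e \<in> {1, 2, 3}" by simp_all
  have *: "\<forall>f\<in>set (es @ B). meets e f \<longrightarrow> g e \<noteq> g f" using l(2) unfolding fits_map .
  have **: "meets e f \<longleftrightarrow> meets f e" for e f :: "'a \<times> 'a" unfolding meets_iff by (simp add: Int_commute)
  note IH = Cons.IH[OF l(1) Cons.prems(2)]
  show ?case
  proof (intro conjI ballI impI)
    fix x assume "x \<in> set ((e # es) @ B)"
    then have "x = e \<or> x \<in> set (es @ B)" by simp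
    then show "g x \<in> {1, 2, 3}" using IH l(3) by blast
  next
    fix x z assume "x \<in> set ((e # es) @ B)" "z \<in> set ((e # es) @ B)" "x \<noteq> z" "meets x z"
    then have "x = e \<or> x \<in> set (es @ B)" "z = e \<or> z \<in> set (es @ B)" "x \<noteq> z" "meets x z" by simp_all
    then show "g x \<noteq> g z" using IH * ** by metis
  qed
qed

text \<open>The default 0 is the value that proper colorings take outside the edge set.\<close>

definition coloring_of :: "('v \<times> 'v) list \<Rightarrow> nat list \<Rightarrow> 'v set \<Rightarrow> nat" where
  "coloring_of es ks e = (case map_of (zip (map edge es) ks) e of None \<Rightarrow> 0 | Some k \<Rightarrow> k)"

lemma map_coloring_of:
  assumes "distinct (map edge es)" "length ks = length es"
  shows "map (\<lambda>e. coloring_of es ks (edge e)) es = ks"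
proof (rule nth_equalityI)
  fix i assume "i < length (map (\<lambda>e. coloring_of es ks (edge e)) es)"
  then have i: "i < length es" by simp
  have "map_of (zip (map edge es) ks) (map edge es ! i) = Some (ks ! i)"
    using i assms by (intro map_of_zip_nth) simp_all
  then show "map (\<lambda>e. coloring_of es ks (edge e)) es ! i = ks ! i" using i by (simp add: coloring_of_def)
qed (use assms in simp)

lemma proper_coloring_of:
  assumes "legal B es ks" "length B = 3" "distinct (map edge (es @ B))"
  shows "proper_3_edge_coloring (edge ` set (es @ B)) (coloring_of (es @ B) ks)"
proof -
  let ?g = "\<lambda>e. coloring_of (es @ B) ks (edge e)"
  have l: "length ks = length (es @ B)" by (rule legal_length[OF assms(1,2)])
  have "legal B es (map ?g (es @ B))" using assms(1) unfolding map_coloring_of[OF assms(3) l] .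
  note L = legal_mapD[OF this assms(2)]
  show ?thesis unfolding proper_3_edge_coloring_def
  proof (intro conjI allI impI)
    show "\<forall>e\<in>edge ` set (es @ B). coloring_of (es @ B) ks e \<in> {1, 2, 3}" using L by (metis (no_types, lifting) imageE)
    show "coloring_of (es @ B) ks e = 0" if "e \<notin> edge ` set (es @ B)" for e
    proof -
      have "map_of (zip (map edge (es @ B)) ks) e = None" using that l by (subst map_of_zip_is_None) (simp_all add: image_Un)
      then show ?thesis by (simp add: coloring_of_def)
    qed
    show "\<forall>e\<in>edge ` set (es @ B). \<forall>f\<in>edge ` set (es @ B). e \<noteq> f \<and> e \<inter> f \<noteq> {} \<longrightarrow> coloring_of (es @ B) ks e \<noteq> coloring_of (es @ B) ks f"
    proof (intro ballI impI)
      fix x z assume "x \<in> edge ` set (es @ B)" "z \<in> edge ` set (es @ B)" and xz: "x \<noteq> z \<and> x \<inter> z \<noteq> {}"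
      then obtain e f where ef: "e \<in> set (es @ B)" "f \<in> set (es @ B)" "x = edge e" "z = edge f" by blast
      then have "e \<noteq> f" "meets e f" using xz by (auto simp: meets_iff)
      then show "coloring_of (es @ B) ks x \<noteq> coloring_of (es @ B) ks z" using L ef by blast
    qed
  qed
qed

definition legal_step :: "('v \<times> 'v) list \<Rightarrow> ('v \<times> 'v) list \<Rightarrow> (nat list \<times> nat list) set" where
  "legal_step B es = {(ks, ls). legal B es ks \<and> legal B es ls \<and> (\<exists>y\<in>set [1, 2, 3]. same_class y ks ls)}"

text \<open>Every coloring found in a round is one step away from the previous frontier, so the
  paths compose over the rounds.\<close>

lemma connects_sound:
  assumes "connects n D T" "\<forall>d\<in>set D. legal B es d" "\<forall>t\<in>set T. legal B es t" "t \<in> set T"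
  shows "\<exists>d\<in>set D. (d, t) \<in> (legal_step B es)\<^sup>*"
  using assms
proof (induction n D T arbitrary: t rule: connects.induct)
  case (3 n D t0 T)
  define Q where "Q = (\<lambda>t. \<exists>d\<in>set D. \<exists>y\<in>set [1, 2, 3]. same_class y d t)"
  define N M where "N = filter Q (t0 # T)" and "M = filter (Not \<circ> Q) (t0 # T)"
  have P: "partition Q (t0 # T) = (N, M)" unfolding N_def M_def by (rule partition_filter_conv)
  have c: "connects n N M" using "3.prems"(1) unfolding connects.simps Let_def Q_def[symmetric] P by simp
  have N: "\<exists>d\<in>set D. (d, u) \<in> (legal_step B es)\<^sup>*" if "u \<in> set N" for u
  proof -
    have u: "u \<in> set (t0 # T)" "Q u" using that unfolding N_def by (simp_all only: set_filter mem_Collect_eq)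
    then obtain d where d: "d \<in> set D" "\<exists>y\<in>set [1, 2, 3]. same_class y d u" unfolding Q_def by blast
    then have "(d, u) \<in> legal_step B es" unfolding legal_step_def using "3.prems"(2,3) u(1) by blast
    then show ?thesis using d(1) by blast
  qed
  show ?case
  proof (cases "t \<in> set N")
    case False
    then have "t \<in> set M" using "3.prems"(4) unfolding N_def M_def by auto
    moreover have "\<forall>d\<in>set N. legal B es d" "\<forall>d\<in>set M. legal B es d"
      using "3.prems"(3) unfolding N_def M_def by (simp_all only: set_filter mem_Collect_eq) blast+
    ultimately obtain u where "u \<in> set N" "(u, t) \<in> (legal_step B es)\<^sup>*"
      using "3.IH"[unfolded Q_def[symmetric], OF P[symmetric], of t] c unfolding P fst_conv snd_conv by blast
    then show ?thesis using N by (meson rtrancl_trans)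
  qed (use N in blast)
qed simp_all

definition swap_colors :: "nat \<Rightarrow> nat \<Rightarrow> ('v set \<Rightarrow> nat) \<Rightarrow> 'v set \<Rightarrow> nat" where
  "swap_colors a b c e = (if c e = a then b else if c e = b then a else c e)"

text \<open>A global exchange of two colors leaves the class of the third one alone, so permuting
  colors stays within the closure of \<open>share_class\<close>.\<close>

lemma proper_swap_colors:
  assumes c: "proper_3_edge_coloring E c" and ab: "a \<in> {1, 2, 3}" "b \<in> {1, 2, 3}"
  shows "proper_3_edge_coloring E (swap_colors a b c)" "(c, swap_colors a b c) \<in> (share_class E)\<^sup>*"
proof -
  have z: "a \<noteq> 0" "b \<noteq> 0" using ab by auto
  show p: "proper_3_edge_coloring E (swap_colors a b c)" unfolding proper_3_edge_coloring_def
  proof (intro conjI ballI allI impI)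
    fix e assume "e \<in> E" then show "swap_colors a b c e \<in> {1, 2, 3}" using properD(1)[OF c] ab unfolding swap_colors_def by simp
  next
    fix e assume "e \<notin> E" then show "swap_colors a b c e = 0" using properD(2)[OF c] z unfolding swap_colors_def by simp
  next
    fix e f assume "e \<in> E" "f \<in> E" "e \<noteq> f \<and> e \<inter> f \<noteq> {}"
    then have "c e \<noteq> c f" using properD(3)[OF c] by blast
    then show "swap_colors a b c e \<noteq> swap_colors a b c f" unfolding swap_colors_def by simp
  qed
  show "(c, swap_colors a b c) \<in> (share_class E)\<^sup>*"
  proof (cases "a = b")
    case True
    then have "swap_colors a b c = c" by (auto simp: swap_colors_def)
    then show ?thesis by simp
  next
    case False
    note t = third_color[OF ab False]
    have "\<forall>e\<in>E. c e = 6 - a - b \<longleftrightarrow> swap_colors a b c e = 6 - a - b" using t(2,3) unfolding swap_colors_def by auto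
    then have "(c, swap_colors a b c) \<in> share_class E" unfolding share_class_def using c p t(1) by blast
    then show ?thesis by blast
  qed
qed

lemma normalize_coloring:
  assumes c: "proper_3_edge_coloring E c" and E: "e1 \<in> E" "e2 \<in> E" "e3 \<in> E"
    and ne: "e1 \<noteq> e2" "e1 \<noteq> e3" "e2 \<noteq> e3" "e1 \<inter> e2 \<noteq> {}" "e1 \<inter> e3 \<noteq> {}" "e2 \<inter> e3 \<noteq> {}"
  obtains d where "proper_3_edge_coloring E d" "(c, d) \<in> (share_class E)\<^sup>*" "d e1 = 1" "d e2 = 2" "d e3 = 3"
proof -
  have v: "c e1 \<in> {1, 2, 3}" by (rule properD(1)[OF c E(1)])
  define c' where "c' = swap_colors (c e1) 1 c"
  have c': "proper_3_edge_coloring E c'" "(c, c') \<in> (share_class E)\<^sup>*"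
    using proper_swap_colors[OF c v, of 1] by (simp_all add: c'_def)
  have 1: "c' e1 = 1" by (simp add: c'_def swap_colors_def)
  have v': "c' e2 \<in> {1, 2, 3}" by (rule properD(1)[OF c'(1) E(2)])
  \<comment> \<open>Ensures that the second exchange does not disturb color 1 on \<open>e1\<close>;
    the color of \<open>e3\<close> is then forced.\<close>
  have "c' e2 \<noteq> 1" using properD(3)[OF c'(1) E(1,2) ne(1,4)] 1 by simp
  define d where "d = swap_colors (c' e2) 2 c'"
  have d: "proper_3_edge_coloring E d" "(c', d) \<in> (share_class E)\<^sup>*"
    using proper_swap_colors[OF c'(1) v', of 2] by (simp_all add: d_def)
  have d12: "d e1 = 1" "d e2 = 2" using 1 \<open>c' e2 \<noteq> 1\<close> by (simp_all add: d_def swap_colors_def)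
  have "d e1 + d e2 + d e3 = 6"
    by (rule sum_three_colors) (rule properD(1)[OF d(1)] properD(3)[OF d(1)] E ne)+
  then have "d e3 = 3" using d12 by simp
  then show ?thesis using that[OF d(1) _ d12] c'(2) d(2) by (meson rtrancl_trans)
qed

text \<open>Every coloring is first moved to one with colors 1, 2, 3 on the three fixed edges; all
  of those are listed and are reached from the head of the list.\<close>

lemma linked_by_enumeration:
  assumes dist: "distinct (map edge (es @ [b1, b2, b3]))" and E: "E = edge ` set (es @ [b1, b2, b3])"
    and B: "meets b1 b2" "meets b1 b3" "meets b2 b3"
    and ne: "colorings [b1, b2, b3] es \<noteq> []"
    and con: "connects n [hd (colorings [b1, b2, b3] es)] (tl (colorings [b1, b2, b3] es))"
  shows "linked E"
proof -
  let ?B = "[b1, b2, b3]" and ?C = "colorings [b1, b2, b3] es"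
  let ?col = "coloring_of (es @ ?B)"
  have len: "length ?B = 3" by simp
  define k where "k = hd ?C"
  have C: "set ?C = insert k (set (tl ?C))" using ne unfolding k_def by (cases ?C) simp_all
  then have k: "legal ?B es k" using set_colorings by blast
  have tl: "\<forall>t\<in>set (tl ?C). legal ?B es t" using C set_colorings by blast
  have pc: "proper_3_edge_coloring E (?col ks)" if "legal ?B es ks" for ks
    unfolding E by (rule proper_coloring_of[OF that len dist])
  have reach: "(k, ks) \<in> (legal_step ?B es)\<^sup>*" if "legal ?B es ks" for ks
  proof -
    have "ks = k \<or> ks \<in> set (tl ?C)" using that C set_colorings by blast
    then show ?thesis using connects_sound[OF con, of ?B es ks] k tl unfolding k_def[symmetric] by auto
  qed
  have step: "(?col ks, ?col ls) \<in> share_class E" if "(ks, ls) \<in> legal_step ?B es" for ks ls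
  proof -
    from that obtain y where l: "legal ?B es ks" "legal ?B es ls" and y: "y \<in> {1, 2, 3}" "same_class y ks ls"
      unfolding legal_step_def by auto
    have "map (\<lambda>e. ?col ks (edge e)) (es @ ?B) = ks" "map (\<lambda>e. ?col ls (edge e)) (es @ ?B) = ls"
      by (rule map_coloring_of[OF dist], rule legal_length[OF _ len], rule l)+
    then have "same_class y (map (\<lambda>e. ?col ks (edge e)) (es @ ?B)) (map (\<lambda>e. ?col ls (edge e)) (es @ ?B))"
      using y(2) by (simp only:)
    then have "\<forall>e\<in>set (es @ ?B). ?col ks (edge e) = y \<longleftrightarrow> ?col ls (edge e) = y"
      unfolding same_class_map .
    then have "\<forall>e\<in>E. ?col ks e = y \<longleftrightarrow> ?col ls e = y" unfolding E by blast
    then show ?thesis unfolding share_class_def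
      using pc[OF l(1)] pc[OF l(2)] y(1) by blast
  qed
  have col: "(?col k, ?col ks) \<in> (share_class E)\<^sup>*" if "legal ?B es ks" for ks
    using reach[OF that] by (induction rule: rtrancl_induct) (auto intro: rtrancl_into_rtrancl step)
  have all: "(?col k, c) \<in> (share_class E)\<^sup>*" if c: "proper_3_edge_coloring E c" for c
  proof -
    have b: "edge b1 \<in> E" "edge b2 \<in> E" "edge b3 \<in> E" "edge b1 \<noteq> edge b2" "edge b1 \<noteq> edge b3" "edge b2 \<noteq> edge b3"
      using dist unfolding E by auto
    obtain d where d: "proper_3_edge_coloring E d" "(c, d) \<in> (share_class E)\<^sup>*" "d (edge b1) = 1" "d (edge b2) = 2" "d (edge b3) = 3"
      using normalize_coloring[OF c b B[unfolded meets_iff]] by blast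
    define ks where "ks = map (\<lambda>e. d (edge e)) (es @ ?B)"
    have l: "legal ?B es ks" unfolding ks_def
    proof (rule legal_mapI)
      show "map (\<lambda>e. d (edge e)) ?B = [1, 2, 3]" using d(3-5) by simp
      show "distinct (map edge (es @ ?B))" by (rule dist)
      show "d (edge e) \<in> {1, 2, 3}" if "e \<in> set (es @ ?B)" for e
        by (rule properD(1)[OF d(1)]) (use that E in blast)
      show "d (edge e) \<noteq> d (edge f)" if "e \<in> set (es @ ?B)" "f \<in> set (es @ ?B)" "edge e \<noteq> edge f" "meets e f" for e f
        by (rule properD(3)[OF d(1)]) (use that E in \<open>blast, blast, blast, simp add: meets_iff\<close>)
    qed
    have "map (\<lambda>e. ?col ks (edge e)) (es @ ?B) = map (\<lambda>e. d (edge e)) (es @ ?B)"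
      using map_coloring_of[OF dist legal_length[OF l len]] unfolding ks_def .
    then have "\<forall>e\<in>set (es @ ?B). ?col ks (edge e) = d (edge e)" unfolding map_eq_conv .
    then have "?col ks e = d e" if "e \<in> E" for e using that unfolding E by blast
    moreover have "?col ks e = d e" if "e \<notin> E" for e
      using properD(2)[OF pc[OF l] that] properD(2)[OF d(1) that] by simp
    ultimately have "?col ks e = d e" for e by (cases "e \<in> E")
    then have "?col ks = d" by (rule ext)
    then have "(?col k, d) \<in> (share_class E)\<^sup>*" using col[OF l] by simp
    moreover have "(d, c) \<in> (share_class E)\<^sup>*" using d(2) sym_rtrancl[OF sym_share_class] by (meson symD)
    ultimately show ?thesis by (rule rtrancl_trans)
  qed
  show ?thesis unfolding linked_def
  proof (intro conjI allI impI)
    show "\<exists>c. proper_3_edge_coloring E c" using pc[OF k] by blast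
    fix c d assume "proper_3_edge_coloring E c" "proper_3_edge_coloring E d"
    then show "(c, d) \<in> (share_class E)\<^sup>*"
      using all sym_rtrancl[OF sym_share_class] by (meson symD rtrancl_trans)
  qed
qed

section \<open>The two families of graphs\<close>

lemma card_doubleton_Int: "a \<noteq> b \<Longrightarrow> card ({a, b} \<inter> A) = 1 \<longleftrightarrow> (a \<in> A \<longleftrightarrow> b \<notin> A)"
  by (cases "a \<in> A"; cases "b \<in> A") (simp_all add: Int_insert_left)

lemma (in longer_ladder) bipartite_longer:
  assumes "bipartite V E"
  shows "bipartite (insert x2 (insert y2 (insert x1 (insert y1 V)))) E'"
proof -
  obtain A where A: "A \<subseteq> V" "\<And>e. e \<in> E \<Longrightarrow> card (e \<inter> A) = 1" using assms unfolding bipartite_def by blast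
  have side: "a2 \<in> A \<longleftrightarrow> b2 \<notin> A" "a2 \<in> A \<longleftrightarrow> r \<notin> A" "b2 \<in> A \<longleftrightarrow> s \<notin> A"
    by (rule card_doubleton_Int[THEN iffD1]; (rule A(2), rule lad_edges)?; simp add: nes)+
  have new_A: "x1 \<notin> A" "x2 \<notin> A" "y1 \<notin> A" "y2 \<notin> A" using A(1) newV by blast+
  \<comment> \<open>The sides alternate along \<open>a2\<close>, \<open>x1\<close>,
    \<open>x2\<close>, \<open>r\<close> and along \<open>b2\<close>, \<open>y1\<close>,
    \<open>y2\<close>, \<open>s\<close>; as \<open>a2\<close> and \<open>b2\<close> are on opposite
    sides, so are the ends of the new rungs.\<close>
  define A' where "A' = A \<union> (if a2 \<in> A then {x2, y1} else {x1, y2})"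
  have "card (e \<inter> A') = 1" if "e \<in> E'" for e
    using that
  proof (cases rule: E'_cases)
    case 1
    then have "e \<inter> A' = e \<inter> A" using new_notin[OF old_in(2)[OF 1]] by (auto simp: A'_def)
    then show ?thesis using A(2)[OF old_in(2)[OF 1]] by simp
  next
    case 2
    have mem: "a2 \<in> A' \<longleftrightarrow> a2 \<in> A" "b2 \<in> A' \<longleftrightarrow> a2 \<notin> A" "r \<in> A' \<longleftrightarrow> a2 \<notin> A" "s \<in> A' \<longleftrightarrow> a2 \<in> A"
      "x1 \<in> A' \<longleftrightarrow> a2 \<notin> A" "x2 \<in> A' \<longleftrightarrow> a2 \<in> A" "y1 \<in> A' \<longleftrightarrow> a2 \<in> A" "y2 \<in> A' \<longleftrightarrow> a2 \<notin> A"
      using side new_A by (auto simp: A'_def nes)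
    show ?thesis using 2 unfolding new_edges_def
      by (elim insertE emptyE; simp only:; subst card_doubleton_Int; simp add: nes mem)
  qed
  moreover have "A' \<subseteq> insert x2 (insert y2 (insert x1 (insert y1 V)))" using A(1) by (auto simp: A'_def)
  ultimately show ?thesis unfolding bipartite_def by blast
qed

lemma (in longer_ladder) nonplanar_cubic_longer:
  assumes "nonplanar_cubic V E"
  shows "nonplanar_cubic (insert x2 (insert y2 (insert x1 (insert y1 V)))) E'"
  unfolding add_rungs_def
proof (rule nonplanar_cubic_h_insert[OF nonplanar_cubic_h_insert[OF assms lad_edges(5,8) e1_ne_f1]])
  show "{x1,r} \<in> h_insert a2 r b2 s x1 y1 E" "{y1,s} \<in> h_insert a2 r b2 s x1 y1 E" by (simp_all add: h_insert_def)
qed (use newV in \<open>simp_all add: nes doubleton_eq_iff\<close>)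

text \<open>The old rungs keep their names and only the neighbors beyond them change, so the next
  pair of rungs is inserted in the same place.\<close>

lemma (in longer_ladder) ladder_longer: "ladder (insert x2 (insert y2 (insert x1 (insert y1 V)))) E' a0 a1 a2 x1 b0 b1 b2 y1"
proof unfold_locales
  interpret h: h_insertion V E a2 r b2 s x1 y1
    by unfold_locales (use graph lad_edges e1_ne_f1 newV nes in auto)
  interpret h': h_insertion "insert x1 (insert y1 V)" "h_insert a2 r b2 s x1 y1 E" x1 r y1 s x2 y2
    by unfold_locales (use h.simple' newV in \<open>simp_all add: h_insert_def nes doubleton_eq_iff\<close>)
  show "simple_graph (insert x2 (insert y2 (insert x1 (insert y1 V)))) E'"
    unfolding add_rungs_def by (rule h'.simple')
qed (simp_all only: inc_old, simp_all add: nes)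

section \<open>The base graphs on 12 and 18 vertices\<close>

definition "L12 = [(1, 5), (1, 4), (0, 5), (0, 4), (5, 6), (8, 4), (8, 9), (6, 9), (6, 2), (2, 8), (11, 1), (10, 9), (10, 11), (7, 0), (7, 10::nat)]"

definition "L18 = [(12, 13), (0, 13), (15, 12), (0, 15), (0, 14), (17, 15), (14, 17), (16, 17), (16, 12), (13, 5), (4, 16), (1, 5), (1, 4), (5, 6), (8, 4), (8, 9), (6, 9), (11, 1), (10, 9), (10, 11), (7, 10), (14, 7), (3, 7), (3, 11::nat)]"

text \<open>
  Both graphs were found by computer search. \<open>E18\<close> arises from \<open>E12\<close> by replacing vertex 0 with a cube minus a
  vertex. They share the ladder with rails 3, 2, 8, 4 and 5, 6, 9, 10 and rungs \<open>{2,6}\<close> and \<open>{8,9}\<close>.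
\<close>
definition E12 :: "nat set set" where
  "E12 = h_insert 7 9 3 1 10 11 (h_insert 2 4 6 7 8 9 (h_insert 5 2 3 0 6 7 K33))"

definition E18 :: "nat set set" where
  "E18 = h_insert 4 12 14 15 16 17 (h_insert 0 7 0 12 14 15 (h_insert 0 4 0 5 12 13 E12))"

lemma E12_eq: "E12 = {{7,10}, {10,9}, {3,11}, {11,1}, {10,11}, {2,8}, {8,4}, {6,9}, {8,9}, {5,6}, {6,2}, {3,7}, {7,0}, {0,4}, {0,5}, {1,4}, {1,5}, {2,3}}"
  unfolding E12_def h_insert_def K33_def by (simp add: insert_Diff_if doubleton_eq_iff del: Un_insert_right)

lemma E18_eq: "E18 = {{4,16}, {16,12}, {14,17}, {17,15}, {16,17}, {0,14}, {14,7}, {0,15}, {15,12}, {0,13}, {13,5}, {12,13}, {7,10}, {10,9}, {3,11}, {11,1}, {10,11}, {2,8}, {8,4}, {6,9}, {8,9}, {5,6}, {6,2}, {3,7}, {1,4}, {1,5}, {2,3}}"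
  unfolding E18_def h_insert_def E12_eq by (simp add: insert_Diff_if doubleton_eq_iff del: Un_insert_right)

lemma nonplanar_cubic_h_insert_nat:
  assumes "nonplanar_cubic {0..<n} E" "{a, b} \<in> E" "{c, d} \<in> E" "{a, b} \<noteq> {c, d}" "m = Suc n" "k = Suc m"
  shows "nonplanar_cubic {0..<k} (h_insert a b c d n m E)"
proof -
  have "insert n (insert m {0..<n}) = {0..<k}" using assms(5,6) by auto
  then show ?thesis using nonplanar_cubic_h_insert[OF assms(1-4), of n m] assms(5) by simp
qed

lemma nonplanar_cubic_E12: "nonplanar_cubic {0..<12} E12"
  unfolding E12_def
  by (rule nonplanar_cubic_h_insert_nat[OF nonplanar_cubic_h_insert_nat[OF nonplanar_cubic_h_insert_nat[OF nonplanar_cubic_K33, where k = 8], where k = 10]])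
    (simp_all add: h_insert_def K33_def doubleton_eq_iff)

lemma nonplanar_cubic_E18: "nonplanar_cubic {0..<18} E18"
  unfolding E18_def
  by (rule nonplanar_cubic_h_insert_nat[OF nonplanar_cubic_h_insert_nat[OF nonplanar_cubic_h_insert_nat[OF nonplanar_cubic_E12, where k = 14], where k = 16]])
    (simp_all add: h_insert_def E12_eq doubleton_eq_iff)

text \<open>The sides are given for the final edge list, since the insertions that build the graph
  pass through nonbipartite graphs.\<close>

lemma bipartite_E12: "bipartite {0..<12} E12"
  unfolding bipartite_def
proof (intro exI conjI ballI)
  let ?A = "{0, 1, 3, 6, 8, 10} :: nat set"
  show "?A \<subseteq> {0..<12}" by simp
  show "card (e \<inter> ?A) = 1" if "e \<in> E12" for e
    using that unfolding E12_eq by (elim insertE emptyE) simp_all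
qed

lemma linked_E12: "linked E12"
proof (rule linked_by_enumeration)
  let ?B = "[(3, 11), (3, 7), (2, 3)]"
  show "distinct (map edge (L12 @ ?B))" by (simp add: edge_def L12_def doubleton_eq_iff)
  show "E12 = edge ` set (L12 @ ?B)"
  proof
    show "E12 \<subseteq> edge ` set (L12 @ ?B)" unfolding E12_eq L12_def edge_def by simp
    show "edge ` set (L12 @ ?B) \<subseteq> E12" unfolding E12_eq L12_def edge_def by simp
  qed
  show "colorings ?B L12 \<noteq> []" by code_simp
  \<comment> \<open>The enumeration colors the list from its end, where every edge of
    \<open>L12\<close> meets one colored before, which prunes early. The number 10 bounds the rounds
    of the search.\<close>
  show "connects 10 [hd (colorings ?B L12)] (tl (colorings ?B L12))" by code_simp
qed simp_all

lemma ladder_E12: "ladder {0..<12} E12 3 2 8 4 5 6 9 10"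
proof unfold_locales
  show "simple_graph {0..<12} E12" using nonplanar_cubic_E12 by (simp add: nonplanar_cubic_def)
  show "{e \<in> E12. 2 \<in> e} = {{3, 2}, {2, 6}, {2, 8}}" "{e \<in> E12. 8 \<in> e} = {{2, 8}, {8, 9}, {8, 4}}"
    "{e \<in> E12. 6 \<in> e} = {{5, 6}, {2, 6}, {6, 9}}" "{e \<in> E12. 9 \<in> e} = {{6, 9}, {8, 9}, {9, 10}}"
    unfolding E12_eq Collect_insert_conj by (simp_all add: insert_commute)
qed simp_all

lemma bipartite_E18: "bipartite {0..<18} E18"
  unfolding bipartite_def
proof (intro exI conjI ballI)
  let ?A = "{0, 2, 4, 5, 7, 9, 11, 12, 17} :: nat set"
  show "?A \<subseteq> {0..<18}" by simp
  show "card (e \<inter> ?A) = 1" if "e \<in> E18" for e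
    using that unfolding E18_eq by (elim insertE emptyE) simp_all
qed

lemma linked_E18: "linked E18"
proof (rule linked_by_enumeration)
  let ?B = "[(2, 8), (6, 2), (2, 3)]"
  show "distinct (map edge (L18 @ ?B))" by (simp add: edge_def L18_def doubleton_eq_iff)
  show "E18 = edge ` set (L18 @ ?B)"
  proof
    show "E18 \<subseteq> edge ` set (L18 @ ?B)" unfolding E18_eq L18_def edge_def by simp
    show "edge ` set (L18 @ ?B) \<subseteq> E18" unfolding E18_eq L18_def edge_def by simp
  qed
  show "colorings ?B L18 \<noteq> []" by code_simp
  show "connects 10 [hd (colorings ?B L18)] (tl (colorings ?B L18))" by code_simp
qed simp_all

lemma ladder_E18: "ladder {0..<18} E18 3 2 8 4 5 6 9 10"
proof unfold_locales
  show "simple_graph {0..<18} E18" using nonplanar_cubic_E18 by (simp add: nonplanar_cubic_def)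
  show "{e \<in> E18. 2 \<in> e} = {{3, 2}, {2, 6}, {2, 8}}" "{e \<in> E18. 8 \<in> e} = {{2, 8}, {8, 9}, {8, 4}}"
    "{e \<in> E18. 6 \<in> e} = {{5, 6}, {2, 6}, {6, 9}}" "{e \<in> E18. 9 \<in> e} = {{6, 9}, {8, 9}, {9, 10}}"
    unfolding E18_eq Collect_insert_conj by (simp_all add: insert_commute)
qed simp_all

text \<open>The invariant of the extension step: six ladder vertices stay fixed, while
  \<open>r\<close> and \<open>s\<close> change each time.\<close>

definition example_graph :: "nat \<Rightarrow> nat set set \<Rightarrow> bool" where
  "example_graph n E \<longleftrightarrow> nonplanar_cubic {0..<n} E \<and> bipartite {0..<n} E \<and> linked E \<and> (\<exists>r s. ladder {0..<n} E 3 2 8 r 5 6 9 s)"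

lemma example_graph_step:
  assumes "example_graph n E"
  shows "\<exists>E'. example_graph (n + 4) E'"
proof -
  obtain r s where l: "ladder {0..<n} E 3 2 8 r 5 6 9 s" using assms unfolding example_graph_def by blast
  interpret longer_ladder "{0..<n}" E 3 2 8 r 5 6 9 s n "n + 1" "n + 2" "n + 3"
    by (intro longer_ladder.intro l) (unfold_locales, simp_all)
  have "insert (n + 2) (insert (n + 3) (insert n (insert (n + 1) {0..<n}))) = {0..<n + 4}" by auto
  then have "example_graph (n + 4) E'"
    using nonplanar_cubic_longer bipartite_longer linked_longer ladder_longer assms unfolding example_graph_def by auto
  then show ?thesis by blast
qed

lemma example_graph_exists:
  assumes "example_graph m E"
  shows "\<exists>E'. example_graph (m + 4 * k) E'"
proof (induction k)
  case 0
  then show ?case using assms by auto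
next
  case (Suc k)
  then obtain E' where "example_graph (m + 4 * k) E'" by blast
  from example_graph_step[OF this] show ?case by (simp add: algebra_simps)
qed

theorem theorem18:
  fixes n :: nat
  assumes "even n" and "n \<ge> 18"
  shows "\<exists>(V :: nat set) (E :: nat set set).
           simple_graph V E \<and> card V = n \<and> \<not> planar V E \<and> bipartite V E \<and>
           k_connected 3 V E \<and> cubic V E \<and> edge_kempe_classes E = 1"
proof -
  have "example_graph 12 E12" "example_graph 18 E18"
    unfolding example_graph_def using nonplanar_cubic_E12 bipartite_E12 linked_E12 ladder_E12 nonplanar_cubic_E18 bipartite_E18 linked_E18 ladder_E18 by blast+
  \<comment> \<open>Multiples of 4 come from the graph on 12 vertices, the other even numbers from
    the one on 18, the least of them in the range.\<close>
  moreover have "\<exists>k. n = 12 + 4 * k \<or> n = 18 + 4 * k" using assms by presburger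
  ultimately obtain E where E: "example_graph n E" using example_graph_exists by blast
  then have s: "simple_graph {0..<n} E" by (simp add: example_graph_def nonplanar_cubic_def)
  then have "E \<subseteq> Pow {0..<n}" by (auto simp: simple_graph_def)
  then have "finite E" by (rule finite_subset) simp
  then have "edge_kempe_classes E = 1" using E by (intro edge_kempe_classes_linked) (simp_all add: example_graph_def)
  then show ?thesis using E s by (intro exI[of _ "{0..<n}"] exI[of _ E]) (simp add: example_graph_def nonplanar_cubic_def)
qed

end
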